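(* Let $d\ge2$, let $(g_j)_{j\ge1}$ be a Markov chain with values in $GL(d,\mathbb{R})$ and let $x_0\in\mathbb{R}^d$ be a fixed unit vector. Suppose that for all $k$ and all $m$ the law of $(g_{k+m},\dots,g_{k+1})$ given $g_k$ is absolutely continuous with respect to the unconditioned law of $(g_{k+m},\dots,g_{k+1})$, with uniformly bounded densities. Assume also that $$\sup_j\|N(g_j)\|_{L^\infty}<\infty$$ and that there exist $n_0\in\mathbb{N}$ and $\delta>0$ such that for every $j$ and every two distinct directions $\bar x,\bar y\in P(\mathbb{R}^d)$, $$\mathbb{E}\left[\ln\left(\frac{d(g_{j,n_0}\bar x,g_{j,n_0}\bar y)}{d(\bar x,\bar y)}\right)\Big|\,g_{j-1}\right]\le-\delta\quad\text{almost surely}.$$ Extend $(g_j)$ to a two-sided sequence by setting $g_k=A$ for $k<1$, for some fixed invertible matrix $A$. Then there exists $\rho\in(0,1)$ such that for all finite $p\ge1$, $$\sup_k\sup_r\rho^{-r/p}\left\|X_k-\mathbb{E}[X_k\,|\,g_k,g_{k-1},\dots,g_{k-r}]\right\|_{L^p}<\infty ,$$ where the suprema are over integers $k\ge1$ and $r\ge0$.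
   Context: $\|\cdot\|$ is the Euclidean norm and the induced operator norm; $N(g)=\max(\|g\|,\|g^{-1}\|)$. On the projective space $P(\mathbb{R}^d)$, $d(\bar x,\bar y)=\|x\wedge y\|$ where $x,y$ are unit vectors with directions $\bar x,\bar y$ (the sine of the angle between them). $g_{j,n}=g_{j+n-1}\cdots g_{j+1}g_j$, acting on $P(\mathbb{R}^d)$ in the natural way. For $y\neq0$, $\sigma(g,y)=\ln(\|gy\|/\|y\|)$, and $X_k=\sigma(g_k,\,g_{k-1}\cdots g_1x_0)$ for $k\ge1$ (with $X_1=\sigma(g_1,x_0)$). For $j=1$ the conditioning on $g_0=A$ is trivial. *)

theory Defs
  imports "HOL-Probability.Probability"
begin

section \<open>Matrices and the projective space\<close>

definition matrix_size :: "real^'n^'n \<Rightarrow> real" where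
  "matrix_size A = max (onorm ((*v) A)) (onorm ((*v) (matrix_inv A)))"

definition log_cocycle :: "real^'n^'n \<Rightarrow> real^'n \<Rightarrow> real" where
  "log_cocycle A y = ln (norm (A *v y) / norm y)"

text \<open>A point of the projective space is a line through the origin; a matrix \<open>A\<close> acts on lines by
  \<open>L \<mapsto> (*v) A ` L\<close>.\<close>

definition proj_space :: "(real^'n) set set" where
  "proj_space = {span {x} |x. x \<noteq> 0}"

text \<open>The bivector \<open>x \<and> y\<close> is represented by the antisymmetric matrix of its Pluecker coordinates
  \<open>x\<^sub>i y\<^sub>j - x\<^sub>j y\<^sub>i\<close>. Each coordinate with \<open>i < j\<close> occurs twice in it up to sign, whence the factor
  \<open>sqrt 2\<close>: the vectors \<open>e\<^sub>i \<and> e\<^sub>j\<close> with \<open>i < j\<close> are to be orthonormal.\<close>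

definition wedge :: "real^'n \<Rightarrow> real^'n \<Rightarrow> real^'n^'n" where
  "wedge x y = (\<chi> i j. x $ i * y $ j - x $ j * y $ i)"

definition wedge_norm :: "real^'n \<Rightarrow> real^'n \<Rightarrow> real" where
  "wedge_norm x y = norm (wedge x y) / sqrt 2"

definition proj_dist :: "(real^'n) set \<Rightarrow> (real^'n) set \<Rightarrow> real" where
  "proj_dist K L = (THE r. \<exists>x\<in>K. \<exists>y\<in>L. norm x = 1 \<and> norm y = 1 \<and> r = wedge_norm x y)"

lemma wedge_norm_power2: "(wedge_norm x y)\<^sup>2 = (norm x)\<^sup>2 * (norm y)\<^sup>2 - (x \<bullet> y)\<^sup>2"
proof -
  have *: "(norm v)\<^sup>2 = (\<Sum>i\<in>UNIV. (v $ i)\<^sup>2)" for v :: "real^'n"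
    unfolding power2_norm_eq_inner by (simp add: inner_vec_def power2_eq_square)
  have "(norm (wedge x y))\<^sup>2 = (\<Sum>i\<in>UNIV. \<Sum>j\<in>UNIV. (x $ i * y $ j - x $ j * y $ i)\<^sup>2)"
    unfolding power2_norm_eq_inner by (simp add: inner_vec_def power2_eq_square wedge_def)
  also have "\<dots> = (\<Sum>i\<in>UNIV. \<Sum>j\<in>UNIV. (x $ i)\<^sup>2 * (y $ j)\<^sup>2)
      + (\<Sum>i\<in>UNIV. \<Sum>j\<in>UNIV. (y $ i)\<^sup>2 * (x $ j)\<^sup>2)
      - 2 * (\<Sum>i\<in>UNIV. \<Sum>j\<in>UNIV. (x $ i * y $ i) * (x $ j * y $ j))"
    by (simp add: power2_eq_square algebra_simps sum.distrib sum_subtractf sum_distrib_left)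
  also have "\<dots> = 2 * ((norm x)\<^sup>2 * (norm y)\<^sup>2 - (x \<bullet> y)\<^sup>2)"
    unfolding * sum_product[symmetric]
    by (simp add: inner_vec_def power2_eq_square)
  finally show ?thesis
    by (simp add: wedge_norm_def power_divide)
qed

lemma wedge_norm_scaleR: "wedge_norm (a *\<^sub>R x) (b *\<^sub>R y) = \<bar>a\<bar> * \<bar>b\<bar> * wedge_norm x y"
proof -
  have "wedge (a *\<^sub>R x) (b *\<^sub>R y) = (a * b) *\<^sub>R wedge x y"
    by (simp add: wedge_def vec_eq_iff algebra_simps)
  then show ?thesis
    by (simp add: wedge_norm_def abs_mult)
qed

lemma proj_dist_span:
  assumes "x \<noteq> 0" "y \<noteq> 0"
  shows "proj_dist (span {x}) (span {y}) = wedge_norm x y / (norm x * norm y)"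
  unfolding proj_dist_def
proof (rule the_equality)
  let ?x = "(1 / norm x) *\<^sub>R x" and ?y = "(1 / norm y) *\<^sub>R y"
  have "?x \<in> span {x}" "?y \<in> span {y}"
    by (auto simp: span_singleton)
  then show "\<exists>u\<in>span {x}. \<exists>v\<in>span {y}. norm u = 1 \<and> norm v = 1 \<and>
      wedge_norm x y / (norm x * norm y) = wedge_norm u v"
    using assms by (intro bexI[of _ ?x] bexI[of _ ?y]) (auto simp: wedge_norm_scaleR)
next
  fix r assume "\<exists>u\<in>span {x}. \<exists>v\<in>span {y}. norm u = 1 \<and> norm v = 1 \<and> r = wedge_norm u v"
  then obtain a b where "\<bar>a\<bar> * norm x = 1" "\<bar>b\<bar> * norm y = 1"
    "r = wedge_norm (a *\<^sub>R x) (b *\<^sub>R y)"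
    by (auto simp: span_singleton)
  then show "r = wedge_norm x y / (norm x * norm y)"
    using assms by (simp add: wedge_norm_scaleR field_simps)
      (metis mult.assoc mult.commute mult.left_neutral)
qed

lemma image_span_singleton: "(*v) A ` span {x} = span {A *v x}" for A :: "real^'n^'n"
  by (auto simp: span_singleton image_def matrix_vector_mult_scaleR)

fun chain_product :: "(int \<Rightarrow> 'a \<Rightarrow> real^'n^'n) \<Rightarrow> int \<Rightarrow> nat \<Rightarrow> 'a \<Rightarrow> real^'n^'n" where
  "chain_product g j 0 \<omega> = mat 1"
| "chain_product g j (Suc n) \<omega> = g (j + int n) \<omega> ** chain_product g j n \<omega>"

definition increment :: "(int \<Rightarrow> 'a \<Rightarrow> real^'n^'n) \<Rightarrow> real^'n \<Rightarrow> int \<Rightarrow> 'a \<Rightarrow> real" where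
  "increment g x\<^sub>0 k \<omega> = log_cocycle (g k \<omega>) (chain_product g 1 (nat (k - 1)) \<omega> *v x\<^sub>0)"


section \<open>Conditioning and Markov chains\<close>

definition tuple :: "'i set \<Rightarrow> ('i \<Rightarrow> 'a \<Rightarrow> 'b) \<Rightarrow> 'a \<Rightarrow> 'i \<Rightarrow> 'b" where
  "tuple I X \<omega> = (\<lambda>i\<in>I. X i \<omega>)"

definition generated_algebra ::
    "'a measure \<Rightarrow> 'i set \<Rightarrow> ('i \<Rightarrow> 'a \<Rightarrow> 'b::topological_space) \<Rightarrow> 'a measure" where
  "generated_algebra M I X =
     vimage_algebra (space M) (tuple I X) (PiM I (\<lambda>_. borel))"

definition joint_law ::
    "'a measure \<Rightarrow> 'i set \<Rightarrow> ('i \<Rightarrow> 'a \<Rightarrow> 'b::topological_space) \<Rightarrow> ('i \<Rightarrow> 'b) measure" where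
  "joint_law M I X = distr M (PiM I (\<lambda>_. borel)) (tuple I X)"

text \<open>\<open>\<kappa>\<close> is a regular version of the conditional law of the random variable \<open>Y\<close>, with values in \<open>S\<close>,
  given the sub-\<open>\<sigma>\<close>-algebra \<open>F\<close>.\<close>

definition regular_cond_law ::
    "'a measure \<Rightarrow> 'a measure \<Rightarrow> 'b measure \<Rightarrow> ('a \<Rightarrow> 'b) \<Rightarrow> ('a \<Rightarrow> 'b measure) \<Rightarrow> bool" where
  "regular_cond_law M F S Y \<kappa> \<longleftrightarrow>
     \<kappa> \<in> F \<rightarrow>\<^sub>M prob_algebra S \<and>
     (\<forall>B\<in>sets S. AE \<omega> in M.
        real_cond_exp M F (indicator (Y -` B \<inter> space M)) \<omega> = measure (\<kappa> \<omega>) B)"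

text \<open>Chains are indexed from \<open>1\<close>, with no assumption of time homogeneity; the values at
  indices below \<open>1\<close> are irrelevant here.\<close>

definition markov_chain :: "'a measure \<Rightarrow> (int \<Rightarrow> 'a \<Rightarrow> 'b::topological_space) \<Rightarrow> bool" where
  "markov_chain M X \<longleftrightarrow>
     (\<forall>j\<ge>1. X j \<in> borel_measurable M) \<and>
     (\<forall>j\<ge>1. \<forall>B\<in>sets borel. AE \<omega> in M.
        real_cond_exp M (generated_algebra M {1..j} X)
          (indicator (X (j + 1) -` B \<inter> space M)) \<omega> =
        real_cond_exp M (generated_algebra M {j} X)
          (indicator (X (j + 1) -` B \<inter> space M)) \<omega>)"

text \<open>The conditional law of a block given the present has a density with respect to the
  unconditioned law of the block, bounded uniformly in the time, in the length of the block and in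
  the value of the present.\<close>

definition bounded_cond_densities ::
    "'a measure \<Rightarrow> (int \<Rightarrow> 'a \<Rightarrow> 'b::topological_space) \<Rightarrow> bool" where
  "bounded_cond_densities M X \<longleftrightarrow>
     (\<exists>C::real. \<forall>k\<ge>1. \<forall>m\<ge>1. \<exists>\<kappa>.
        regular_cond_law M (generated_algebra M {k} X)
          (PiM {k+1..k+m} (\<lambda>_. borel)) (tuple {k+1..k+m} X) \<kappa> \<and>
        (AE \<omega> in M.
           absolutely_continuous (joint_law M {k+1..k+m} X) (\<kappa> \<omega>) \<and>
           (AE v in joint_law M {k+1..k+m} X.
              RN_deriv (joint_law M {k+1..k+m} X) (\<kappa> \<omega>) v \<le> ennreal C)))"


section \<open>The \<open>L\<^sup>p\<close> norm\<close>

text \<open>The value is \<open>\<infinity>\<close> if \<open>\<bar>f\<bar>\<^sup>p\<close> is not integrable.\<close>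

definition Lp_norm :: "'a measure \<Rightarrow> real \<Rightarrow> ('a \<Rightarrow> real) \<Rightarrow> ennreal" where
  "Lp_norm M p f =
     (let I = \<integral>\<^sup>+ \<omega>. ennreal (\<bar>f \<omega>\<bar> powr p) \<partial>M
      in if I = \<infinity> then \<infinity> else ennreal (enn2real I powr (1 / p)))"

end

theory Submission
  imports Defs
begin

text \<open>Only the last \<open>r\<close> factors before time \<open>k\<close> matter much for \<open>X\<^sub>k\<close>, because a long product brings
  any two lines close to one another on average. Let \<open>Y\<close> be \<open>X\<^sub>k\<close> with the vector
  \<open>z = g\<^sub>k\<^sub>-\<^sub>r\<^sub>-\<^sub>1 \<cdots> g\<^sub>1 x\<^sub>0\<close> replaced by \<open>x\<^sub>0\<close>. It is a function of \<open>g\<^sub>k\<^sub>-\<^sub>r, \<dots>, g\<^sub>k\<close>, and \<open>\<sigma>(g\<^sub>k, \<cdot>)\<close> is Lipschitz on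
  the projective space (\<open>log_cocycle_lipschitz\<close>), so \<open>X\<^sub>k - Y\<close> is bounded by a multiple of the distance
  of the images of \<open>z\<close> and \<open>x\<^sub>0\<close> under \<open>g\<^sub>k\<^sub>-\<^sub>1 \<cdots> g\<^sub>k\<^sub>-\<^sub>r\<close>. It remains to see that the mean of this distance
  decays geometrically in \<open>r\<close>.

  The drift hypothesis says that \<open>n\<^sub>0\<close> steps of the chain decrease the logarithm of the distance of
  two fixed lines by \<open>\<delta>\<close> on average. As the logarithm of the ratio is bounded, the expansion
  \<open>exp u \<le> 1 + u + u\<^sup>2\<close> turns this, for a small exponent \<open>s\<close>, into a contraction of the mean of the
  \<open>s\<close>-th power of the distance by a factor less than \<open>1\<close>. The hypothesis conditions on the present only
  and speaks of fixed lines, but to iterate the contraction one needs it for lines that depend on the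
  whole past. The Markov property for blocks (\<open>cond_exp_past_event_block\<close>) passes from the present
  to the past, and an approximation of the lines by finitely many values
  (\<open>integral_freeze_le_0\<close>) passes from fixed lines to random ones. Iteration gives
  \<open>expectation_line_dist_powr_decay\<close>. Since distances are at most \<open>1\<close>, their mean is at most that
  of their \<open>s\<close>-th power.

  Finally, everything is bounded, so an error that is small in \<open>L\<^sup>1\<close> is small in every \<open>L\<^sup>p\<close>: for a
  function bounded by a constant, the \<open>p\<close>-th moment is at most a constant times the mean
  (\<open>Lp_cond_exp_error_le\<close>). This is where the exponent \<open>r/p\<close> comes from.\<close>

section \<open>Matrices that distort lengths by a bounded factor\<close>

text \<open>The projective distance of the lines spanned by \<open>x\<close> and \<open>y\<close> (see \<open>proj_dist_span\<close>), as a function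
  of the spanning vectors: measurability and continuity then refer to
  vectors instead of lines.\<close>

definition line_dist :: "real^'n \<Rightarrow> real^'n \<Rightarrow> real" where
  "line_dist x y = wedge_norm x y / (norm x * norm y)"

definition distortion_le :: "real \<Rightarrow> real^'n^'n \<Rightarrow> bool" where
  "distortion_le c P \<longleftrightarrow> (\<forall>v. norm (P *v v) \<le> c * norm v \<and> norm v \<le> c * norm (P *v v))"

lemma wedge_norm_nonneg [simp]: "0 \<le> wedge_norm x y"
  by (simp add: wedge_norm_def)

lemma wedge_norm_eq_sqrt: "wedge_norm x y = sqrt ((norm x)\<^sup>2 * (norm y)\<^sup>2 - (x \<bullet> y)\<^sup>2)"
  using wedge_norm_power2[of x y] by (metis real_sqrt_abs wedge_norm_nonneg abs_of_nonneg)

lemma wedge_norm_le: "wedge_norm x y \<le> norm x * norm y"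
  by (rule power2_le_imp_le) (simp_all add: wedge_norm_power2 power_mult_distrib)

lemma wedge_norm_shear: "wedge_norm x (y - t *\<^sub>R x) = wedge_norm x y"
  by (simp add: wedge_norm_def wedge_def algebra_simps)

text \<open>A suitable shear by a multiple of \<open>x\<close> makes the parallelogram a rectangle. So its area is the least
  product of two side lengths over all shears, which is how bounds on lengths become bounds on areas.\<close>

lemma wedge_norm_attained: "\<exists>t. wedge_norm x y = norm x * norm (y - t *\<^sub>R x)"
proof (cases "x = 0")
  case True
  then show ?thesis by (simp add: wedge_norm_eq_sqrt)
next
  case False
  define t where "t = (x \<bullet> y) / (x \<bullet> x)"
  have "x \<bullet> (y - t *\<^sub>R x) = 0"
    using False by (simp add: t_def inner_diff_right)
  then have "wedge_norm x (y - t *\<^sub>R x) = norm x * norm (y - t *\<^sub>R x)"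
    by (simp add: wedge_norm_eq_sqrt real_sqrt_mult)
  then show ?thesis
    using wedge_norm_shear by metis
qed

text \<open>For the first bound the shear is chosen to make \<open>x, y\<close> orthogonal, for the second one to make
  the images orthogonal.\<close>

lemma wedge_norm_matrix_le:
  assumes "distortion_le c P" and "c \<ge> 0"
  shows "wedge_norm (P *v x) (P *v y) \<le> c\<^sup>2 * wedge_norm x y"
    and "wedge_norm x y \<le> c\<^sup>2 * wedge_norm (P *v x) (P *v y)"
proof -
  have le: "norm (P *v v) \<le> c * norm v" "norm v \<le> c * norm (P *v v)" for v
    using assms(1) by (auto simp: distortion_le_def)
  have lin: "P *v (y - t *\<^sub>R x) = P *v y - t *\<^sub>R (P *v x)" for t
    by (simp add: matrix_vector_mult_diff_distrib matrix_vector_mult_scaleR)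
  obtain t where t: "wedge_norm x y = norm x * norm (y - t *\<^sub>R x)"
    using wedge_norm_attained by blast
  have "wedge_norm (P *v x) (P *v y) \<le> norm (P *v x) * norm (P *v (y - t *\<^sub>R x))"
    using wedge_norm_le[of "P *v x" "P *v y - t *\<^sub>R (P *v x)"]
    by (simp add: lin wedge_norm_shear)
  also have "\<dots> \<le> (c * norm x) * (c * norm (y - t *\<^sub>R x))"
    by (intro mult_mono le) (use assms in auto)
  finally show "wedge_norm (P *v x) (P *v y) \<le> c\<^sup>2 * wedge_norm x y"
    by (simp add: t power2_eq_square mult_ac)
  obtain t where t: "wedge_norm (P *v x) (P *v y) = norm (P *v x) * norm (P *v y - t *\<^sub>R (P *v x))"
    using wedge_norm_attained by blast
  have "wedge_norm x y \<le> norm x * norm (y - t *\<^sub>R x)"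
    using wedge_norm_le[of x "y - t *\<^sub>R x"] by (simp add: wedge_norm_shear)
  also have "\<dots> \<le> (c * norm (P *v x)) * (c * norm (P *v (y - t *\<^sub>R x)))"
    by (intro mult_mono le) (use assms in auto)
  finally show "wedge_norm x y \<le> c\<^sup>2 * wedge_norm (P *v x) (P *v y)"
    by (simp add: t lin power2_eq_square mult_ac)
qed

lemma line_dist_nonneg [simp]: "0 \<le> line_dist x y"
  by (simp add: line_dist_def)

lemma line_dist_le_1: "line_dist x y \<le> 1"
  using wedge_norm_le[of x y]
  by (cases "x = 0 \<or> y = 0") (auto simp: line_dist_def divide_simps)

lemma line_dist_scaleR: "a \<noteq> 0 \<Longrightarrow> b \<noteq> 0 \<Longrightarrow> line_dist (a *\<^sub>R x) (b *\<^sub>R y) = line_dist x y"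
  by (simp add: line_dist_def wedge_norm_scaleR)

lemma distortion_le_pos:
  assumes "distortion_le c P" "v \<noteq> 0"
  shows "0 < c" "P *v v \<noteq> 0"
proof -
  have "0 < c * norm (P *v v)"
    using assms by (metis distortion_le_def zero_less_norm_iff less_le_trans)
  then show "0 < c" "P *v v \<noteq> 0"
    by (auto simp: zero_less_mult_iff)
qed

lemma distortion_le_mat_1: "distortion_le 1 (mat 1)"
  by (simp add: distortion_le_def)

lemma distortion_le_mult:
  assumes "distortion_le a P" "distortion_le b Q" "0 \<le> a" "0 \<le> b"
  shows "distortion_le (a * b) (P ** Q)"
proof -
  have "norm (P *v (Q *v v)) \<le> a * b * norm v" for v
  proof -
    have "norm (P *v (Q *v v)) \<le> a * norm (Q *v v)"
      using assms by (simp add: distortion_le_def)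
    also have "\<dots> \<le> a * (b * norm v)"
      using assms by (intro mult_left_mono) (auto simp: distortion_le_def)
    finally show ?thesis by (simp add: mult_ac)
  qed
  moreover have "norm v \<le> a * b * norm (P *v (Q *v v))" for v
  proof -
    have "norm v \<le> b * norm (Q *v v)"
      using assms by (simp add: distortion_le_def)
    also have "\<dots> \<le> b * (a * norm (P *v (Q *v v)))"
      using assms by (intro mult_left_mono) (auto simp: distortion_le_def)
    finally show ?thesis by (simp add: mult_ac)
  qed
  ultimately show ?thesis
    by (simp add: distortion_le_def matrix_vector_mul_assoc)
qed

lemma distortion_le_if_matrix_size_le:
  fixes P :: "real^'n^'n"
  assumes "invertible P" "matrix_size P \<le> c"
  shows "distortion_le c P"
proof -
  have *: "norm (Q *v v) \<le> c * norm v" if "onorm ((*v) Q) \<le> c" for Q :: "real^'n^'n" and v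
  proof -
    have "norm (Q *v v) \<le> onorm ((*v) Q) * norm v"
      by (rule onorm) (rule matrix_vector_mul_bounded_linear)
    also have "\<dots> \<le> c * norm v"
      using that by (rule mult_right_mono) simp
    finally show ?thesis .
  qed
  have "onorm ((*v) P) \<le> c" "onorm ((*v) (matrix_inv P)) \<le> c"
    using assms(2) by (auto simp: matrix_size_def)
  moreover have "matrix_inv P *v (P *v v) = v" for v
    using someI_ex[OF assms(1)[unfolded invertible_def]]
    by (simp add: matrix_vector_mul_assoc matrix_inv_def)
  ultimately show ?thesis
    unfolding distortion_le_def using * by metis
qed

text \<open>The distance of two lines is an area divided by two lengths. The area changes by a factor
  between \<open>c\<^sup>-\<^sup>2\<close> and \<open>c\<^sup>2\<close>, each length by one between \<open>c\<^sup>-\<^sup>1\<close> and \<open>c\<close>.\<close>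

lemma abs_ln_line_dist_ratio_le:
  assumes "distortion_le c P" "c \<ge> 1" "wedge_norm x y \<noteq> 0"
  shows "\<bar>ln (line_dist (P *v x) (P *v y) / line_dist x y)\<bar> \<le> 4 * ln c"
proof -
  have nz: "x \<noteq> 0" "y \<noteq> 0"
    using assms(3) by (auto simp: wedge_norm_eq_sqrt)
  have pos: "0 < wedge_norm x y" "0 < norm x" "0 < norm y" "0 < norm (P *v x)" "0 < norm (P *v y)"
    using assms(3) nz distortion_le_pos(2)[OF assms(1)] wedge_norm_nonneg[of x y]
    by (simp_all add: less_le del: wedge_norm_nonneg)
  have le: "norm (P *v v) \<le> c * norm v" "norm v \<le> c * norm (P *v v)" for v
    using assms(1) by (auto simp: distortion_le_def)
  have W: "wedge_norm (P *v x) (P *v y) \<le> c\<^sup>2 * wedge_norm x y"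
    "wedge_norm x y \<le> c\<^sup>2 * wedge_norm (P *v x) (P *v y)"
    using wedge_norm_matrix_le[OF assms(1)] assms(2) by auto
  have posW: "0 < wedge_norm (P *v x) (P *v y)"
  proof (rule ccontr)
    assume "\<not> ?thesis"
    then have "wedge_norm (P *v x) (P *v y) = 0"
      using wedge_norm_nonneg[of "P *v x" "P *v y"] by linarith
    then show False using W(2) pos(1) by simp
  qed
  have ln_le: "\<bar>ln a - ln b\<bar> \<le> k * ln c" if "a \<le> c ^ k * b" "b \<le> c ^ k * a" "0 < a" "0 < b" for a b and k :: nat
  proof -
    have "ln a \<le> ln (c ^ k * b)" "ln b \<le> ln (c ^ k * a)"
      using that assms(2) by (auto simp: ln_le_cancel_iff)
    then show ?thesis
      using that assms(2) by (simp add: ln_mult ln_realpow abs_le_iff)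
  qed
  have "\<bar>ln (wedge_norm (P *v x) (P *v y)) - ln (wedge_norm x y)\<bar> \<le> 2 * ln c"
    using ln_le[of "wedge_norm (P *v x) (P *v y)" 2 "wedge_norm x y"] W posW pos by simp
  moreover have "\<bar>ln (norm (P *v x)) - ln (norm x)\<bar> \<le> ln c" "\<bar>ln (norm (P *v y)) - ln (norm y)\<bar> \<le> ln c"
    using ln_le[of _ 1] le pos by simp_all
  moreover have "ln (line_dist (P *v x) (P *v y) / line_dist x y)
      = (ln (wedge_norm (P *v x) (P *v y)) - ln (wedge_norm x y))
        - (ln (norm (P *v x)) - ln (norm x)) - (ln (norm (P *v y)) - ln (norm y))"
    unfolding line_dist_def using pos posW by (simp add: ln_div ln_mult)
  ultimately show ?thesis
    by linarith
qed

lemma abs_log_cocycle_le: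
  assumes "distortion_le c P" "c \<ge> 1"
  shows "\<bar>log_cocycle P y\<bar> \<le> ln c"
proof (cases "y = 0")
  case True
  then show ?thesis using assms(2) by (simp add: log_cocycle_def)
next
  case False
  have pos: "0 < norm y" "0 < norm (P *v y)"
    using False distortion_le_pos[OF assms(1)] by auto
  have "norm (P *v y) / norm y \<le> c" "1 / c \<le> norm (P *v y) / norm y"
    using assms pos by (auto simp: distortion_le_def divide_simps mult.commute)
  then have "ln (norm (P *v y) / norm y) \<le> ln c" "ln (1 / c) \<le> ln (norm (P *v y) / norm y)"
    using pos assms(2) by (auto simp: ln_le_cancel_iff)
  then show ?thesis
    using assms(2) by (simp add: log_cocycle_def ln_div)
qed

lemma log_cocycle_scaleR: "a \<noteq> 0 \<Longrightarrow> log_cocycle P (a *\<^sub>R x) = log_cocycle P x"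
  by (simp add: log_cocycle_def matrix_vector_mult_scaleR)

text \<open>Both sides depend only on the lines of \<open>x\<close> and \<open>y\<close>, so these may be taken to be unit vectors
  with \<open>x \<bullet> y \<ge> 0\<close>; then \<open>norm (x - y) \<le> 2 * line_dist x y\<close>, and the logarithm of
  \<open>norm (P *v x)\<close> is Lipschitz in \<open>x\<close> on the unit sphere, where \<open>norm (P *v x)\<close> is bounded away from
  \<open>0\<close>.\<close>

lemma log_cocycle_lipschitz:
  assumes P: "distortion_le c P" and c: "c \<ge> 1" and nz: "x \<noteq> 0" "y \<noteq> 0"
  shows "\<bar>log_cocycle P x - log_cocycle P y\<bar> \<le> 2 * c\<^sup>2 * line_dist x y"
proof -
  have acute: "\<bar>log_cocycle P u - log_cocycle P v\<bar> \<le> 2 * c\<^sup>2 * line_dist u v"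
    if u: "norm u = 1" and v: "norm v = 1" and uv: "u \<bullet> v \<ge> 0" for u v
  proof -
    have nz: "u \<noteq> 0" "v \<noteq> 0" using u v by auto
    have pos: "0 < norm (P *v u)" "0 < norm (P *v v)"
      using nz distortion_le_pos[OF P] by auto
    have le: "norm (P *v z) \<le> c * norm z" "norm z \<le> c * norm (P *v z)" for z
      using P by (auto simp: distortion_le_def)
    have "u \<bullet> v \<le> 1"
      using norm_cauchy_schwarz[of u v] u v by simp
    then have "(u \<bullet> v) * (u \<bullet> v) \<le> 1 * (u \<bullet> v)"
      using uv by (intro mult_right_mono) auto
    moreover have "(line_dist u v)\<^sup>2 = 1 - (u \<bullet> v) * (u \<bullet> v)"
      using wedge_norm_power2[of u v] u v by (simp add: line_dist_def power2_eq_square)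
    moreover have "(norm (u - v))\<^sup>2 = 2 - 2 * (u \<bullet> v)"
      using u v by (simp add: power2_norm_eq_inner inner_diff_left inner_diff_right inner_commute
          flip: norm_eq_1) (simp add: norm_eq_1)
    ultimately have "(norm (u - v))\<^sup>2 \<le> (2 * line_dist u v)\<^sup>2"
      using \<open>u \<bullet> v \<le> 1\<close> by (simp add: power_mult_distrib)
    then have uv_le: "norm (u - v) \<le> 2 * line_dist u v"
      by (rule power2_le_imp_le) simp
    have ln_diff: "ln (norm (P *v a)) - ln (norm (P *v b)) \<le> c\<^sup>2 * norm (a - b)"
      if a: "norm a = 1" and b: "norm b = 1" for a b
    proof -
      have nz: "a \<noteq> 0" "b \<noteq> 0" using a b by auto
      have pos: "0 < norm (P *v a)" "0 < norm (P *v b)"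
        using nz distortion_le_pos[OF P] by auto
      have "ln (norm (P *v a)) - ln (norm (P *v b)) = ln (norm (P *v a) / norm (P *v b))"
        using pos by (simp add: ln_div)
      also have "\<dots> \<le> norm (P *v a) / norm (P *v b) - 1"
        using pos by (intro ln_le_minus_one) simp
      also have "\<dots> = (norm (P *v a) - norm (P *v b)) * (1 / norm (P *v b))"
        using pos by (simp add: field_simps)
      also have "\<dots> \<le> norm (P *v (a - b)) * c"
      proof (rule mult_mono)
        show "norm (P *v a) - norm (P *v b) \<le> norm (P *v (a - b))"
          by (simp add: matrix_vector_mult_diff_distrib norm_triangle_ineq2)
        show "1 / norm (P *v b) \<le> c"
          using le(2)[of b] b pos by (simp add: divide_simps mult.commute)
      qed (use pos in auto)
      also have "\<dots> \<le> (c * norm (a - b)) * c"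
        using c by (intro mult_right_mono le) auto
      finally show ?thesis by (simp add: power2_eq_square mult_ac)
    qed
    have "\<bar>log_cocycle P u - log_cocycle P v\<bar> \<le> c\<^sup>2 * norm (u - v)"
      using ln_diff[of u v] ln_diff[of v u] u v
      by (simp add: log_cocycle_def norm_minus_commute abs_le_iff)
    also have "\<dots> \<le> c\<^sup>2 * (2 * line_dist u v)"
      by (intro mult_left_mono uv_le) simp
    finally show ?thesis by simp
  qed
  define a where "a = 1 / norm x"
  define b where "b = (if x \<bullet> y \<ge> 0 then 1 else -1) / norm y"
  have ab: "a \<noteq> 0" "b \<noteq> 0"
    using nz by (auto simp: a_def b_def)
  have "norm (a *\<^sub>R x) = 1" "norm (b *\<^sub>R y) = 1" "(a *\<^sub>R x) \<bullet> (b *\<^sub>R y) \<ge> 0"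
    using nz by (auto simp: a_def b_def divide_simps)
  from acute[OF this] show ?thesis
    using ab by (simp add: log_cocycle_scaleR line_dist_scaleR)
qed

lemma chain_product_add:
  "chain_product g j (m + n) \<omega> = chain_product g (j + int m) n \<omega> ** chain_product g j m \<omega>"
  by (induction n) (simp_all add: matrix_mul_assoc add_ac)

lemma distortion_le_chain_product:
  assumes "\<And>i. i \<ge> j \<Longrightarrow> distortion_le c (g i \<omega>)" "c \<ge> 0"
  shows "distortion_le (c ^ n) (chain_product g j n \<omega>)"
  using assms by (induction n) (auto intro!: distortion_le_mult distortion_le_mat_1)

lemma invertible_chain_product:
  assumes "\<And>i. i \<ge> j \<Longrightarrow> invertible (g i \<omega>)"
  shows "invertible (chain_product g j n \<omega>)"
  using assms by (induction n) (auto intro!: invertible_mult simp: invertible_def[of "mat 1"])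

lemma invertible_mult_vector_nonzero:
  fixes P :: "real^'n^'n"
  assumes "invertible P" "x \<noteq> 0"
  shows "P *v x \<noteq> 0"
  using assms by (metis invertible_left_inverse matrix_vector_mul_assoc matrix_vector_mul_lid
      matrix_vector_mult_0_right)

lemma borel_measurable_line_dist [measurable (raw)]:
  assumes [measurable]: "u \<in> borel_measurable N" "v \<in> borel_measurable N"
  shows "(\<lambda>\<omega>. line_dist (u \<omega>) (v \<omega>)) \<in> borel_measurable N"
  unfolding line_dist_def wedge_norm_eq_sqrt by measurable

lemma borel_measurable_matrix_vector_mult [measurable (raw)]:
  fixes P :: "'a \<Rightarrow> real^'n^'n"
  assumes "P \<in> borel_measurable N" "u \<in> borel_measurable N"
  shows "(\<lambda>\<omega>. P \<omega> *v u \<omega>) \<in> borel_measurable N"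
proof (rule borel_measurable_continuous_Pair[OF assms])
  show "continuous_on UNIV (\<lambda>x. fst x *v snd x :: real^'n)"
    unfolding matrix_vector_mult_def by (intro continuous_intros)
qed

lemma borel_measurable_matrix_matrix_mult [measurable (raw)]:
  fixes P Q :: "'a \<Rightarrow> real^'n^'n"
  assumes "P \<in> borel_measurable N" "Q \<in> borel_measurable N"
  shows "(\<lambda>\<omega>. P \<omega> ** Q \<omega>) \<in> borel_measurable N"
proof (rule borel_measurable_continuous_Pair[OF assms])
  show "continuous_on UNIV (\<lambda>x. fst x ** snd x :: real^'n^'n)"
    unfolding matrix_matrix_mult_def by (intro continuous_intros)
qed

lemma borel_measurable_log_cocycle [measurable (raw)]:
  assumes [measurable]: "P \<in> borel_measurable N" "u \<in> borel_measurable N"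
  shows "(\<lambda>\<omega>. log_cocycle (P \<omega>) (u \<omega>)) \<in> borel_measurable N"
  unfolding log_cocycle_def by measurable

lemma borel_measurable_chain_product:
  assumes "\<And>i. j \<le> i \<Longrightarrow> i < j + int n \<Longrightarrow> g i \<in> borel_measurable N"
  shows "chain_product g j n \<in> borel_measurable N"
proof -
  have "(\<lambda>\<omega>. chain_product g j n \<omega>) \<in> borel_measurable N"
    using assms
  proof (induction n)
    case (Suc n)
    then have "g (j + int n) \<in> borel_measurable N"
      "(\<lambda>\<omega>. chain_product g j n \<omega>) \<in> borel_measurable N"
      by simp_all
    then show ?case
      unfolding chain_product.simps by (rule borel_measurable_matrix_matrix_mult)
  next
    case 0
    show ?case unfolding chain_product.simps by (rule borel_measurable_const)
  qed
  then show ?thesis by simp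
qed

section \<open>The algebra generated by a process\<close>

lemma space_generated_algebra [simp]: "space (generated_algebra M I X) = space M"
  by (simp add: generated_algebra_def)

lemma tuple_in_space_PiM: "tuple I X \<in> S \<rightarrow> space (PiM I (\<lambda>_. borel))"
  by (auto simp: tuple_def space_PiM)

lemma measurable_generated_algebra:
  assumes "i \<in> I"
  shows "X i \<in> borel_measurable (generated_algebra M I X)"
proof -
  have "tuple I X \<in> generated_algebra M I X \<rightarrow>\<^sub>M PiM I (\<lambda>_. borel)"
    unfolding generated_algebra_def by (rule measurable_vimage_algebra1[OF tuple_in_space_PiM])
  from measurable_compose[OF this measurable_component_singleton[OF assms]] show ?thesis
    using assms by (simp add: tuple_def)
qed

lemma sets_generated_algebra_subset:
  assumes "space N = space M" "\<And>i. i \<in> I \<Longrightarrow> X i \<in> borel_measurable N"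
  shows "sets (generated_algebra M I X) \<subseteq> sets N"
  unfolding generated_algebra_def
proof (rule sets_image_in_sets[OF assms(1)])
  show "tuple I X \<in> N \<rightarrow>\<^sub>M PiM I (\<lambda>_. borel)"
    unfolding tuple_def[abs_def] by (rule measurable_restrict) (rule assms(2))
qed

lemma subalgebra_generated_algebra:
  assumes "\<And>i. i \<in> I \<Longrightarrow> X i \<in> borel_measurable M"
  shows "subalgebra M (generated_algebra M I X)"
  using sets_generated_algebra_subset[of M M I X] assms by (simp add: subalgebra_def)

lemma subalgebra_generated_algebra_mono:
  "I \<subseteq> J \<Longrightarrow> subalgebra (generated_algebra M J X) (generated_algebra M I X)"
  unfolding subalgebra_def
  by (intro conjI sets_generated_algebra_subset measurable_generated_algebra) auto

section \<open>The Markov property for blocks\<close>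

lemma (in finite_measure) integrable_bounded:
  fixes f :: "'a \<Rightarrow> real"
  assumes "f \<in> borel_measurable M" "AE \<omega> in M. \<bar>f \<omega>\<bar> \<le> B"
  shows "integrable M f"
  using integrable_const_bound[of f B] assms by simp

lemma (in finite_measure) sigma_finite_subalgebraI:
  "subalgebra M F \<Longrightarrow> sigma_finite_subalgebra M F"
  by (intro finite_measure_subalgebra_is_sigma_finite finite_measure_subalgebra.intro
      finite_measure_subalgebra_axioms.intro finite_measure_axioms)

lemma (in prob_space) abs_cond_exp_le:
  assumes "subalgebra M F" "f \<in> borel_measurable M" "AE \<omega> in M. \<bar>f \<omega>\<bar> \<le> B"
  shows "AE \<omega> in M. \<bar>real_cond_exp M F f \<omega>\<bar> \<le> B"
proof -
  interpret F: sigma_finite_subalgebra M F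
    using assms(1) by (rule sigma_finite_subalgebraI)
  have f: "integrable M f"
    using assms by (intro integrable_bounded)
  have "AE \<omega> in M. f \<omega> \<le> B" "AE \<omega> in M. - B \<le> f \<omega>"
    using assms(3) by (eventually_elim, linarith)+
  then have "AE \<omega> in M. real_cond_exp M F f \<omega> \<le> B" "AE \<omega> in M. - B \<le> real_cond_exp M F f \<omega>"
    using F.real_cond_exp_le_c[OF f] F.real_cond_exp_ge_c[OF f] by blast+
  then show ?thesis by eventually_elim linarith
qed

text \<open>The sets over which \<open>f\<close> and \<open>h\<close> have the same integral form a Dynkin system.\<close>

lemma (in finite_measure) integral_eq_on_generated_sigma_algebra:
  fixes f h :: "'a \<Rightarrow> real"
  assumes f: "integrable M f" and h: "integrable M h"
    and G: "Int_stable G" "G \<subseteq> sets M" "space M \<in> G"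
    and eq: "\<And>E. E \<in> G \<Longrightarrow> (\<integral>\<omega>\<in>E. f \<omega> \<partial>M) = (\<integral>\<omega>\<in>E. h \<omega> \<partial>M)"
    and E: "E \<in> sigma_sets (space M) G"
  shows "(\<integral>\<omega>\<in>E. f \<omega> \<partial>M) = (\<integral>\<omega>\<in>E. h \<omega> \<partial>M)"
proof -
  have sub: "sigma_sets (space M) G \<subseteq> sets M"
    using G(2) by (rule sets.sigma_sets_subset)
  have set_int: "set_integrable M D u" if "integrable M u" "D \<in> sets M" for D and u :: "'a \<Rightarrow> real"
    using integrable_mult_indicator[OF that(2,1)] by (simp add: set_integrable_def)
  have "G \<subseteq> Pow (space M)"
    using G(2) sets.space_closed by blast
  from G(1) this E show ?thesis
  proof (induction E rule: sigma_sets_induct_disjoint)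
    case (basic E)
    then show ?case by (rule eq)
  next
    case empty
    show ?case by (simp add: set_lebesgue_integral_def)
  next
    case (compl E)
    then have E: "E \<in> sets M" using sub by auto
    have *: "(\<integral>\<omega>\<in>space M - E. u \<omega> \<partial>M) = (\<integral>\<omega>\<in>space M. u \<omega> \<partial>M) - (\<integral>\<omega>\<in>E. u \<omega> \<partial>M)"
      if u: "integrable M u" for u :: "'a \<Rightarrow> real"
    proof -
      have "(\<integral>\<omega>\<in>(space M - E) \<union> E. u \<omega> \<partial>M) = (\<integral>\<omega>\<in>space M - E. u \<omega> \<partial>M) + (\<integral>\<omega>\<in>E. u \<omega> \<partial>M)"
        using E u by (intro set_integral_Un set_int) auto
      moreover have "(space M - E) \<union> E = space M"
        using sets.sets_into_space[OF E] by auto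
      ultimately show ?thesis by simp
    qed
    show ?case
      using compl.IH eq[OF G(3)] by (simp add: *[OF f] *[OF h])
  next
    case (union E)
    then have E: "E i \<in> sets M" for i using sub by auto
    have "(\<integral>\<omega>\<in>(\<Union>i. E i). u \<omega> \<partial>M) = (\<Sum>i. \<integral>\<omega>\<in>E i. u \<omega> \<partial>M)"
      if u: "integrable M u" for u :: "'a \<Rightarrow> real"
      using E union.hyps(1) u
      by (intro lebesgue_integral_countable_add set_int) (auto simp: disjoint_family_on_def)
    then show ?case
      using f h union.IH by simp
  qed
qed

locale markov_process = prob_space M for M :: "'a measure" +
  fixes X :: "int \<Rightarrow> 'a \<Rightarrow> 'b::topological_space"
  assumes markov_chain: "markov_chain M X"
    and measurable_X [measurable]: "\<And>i. X i \<in> borel_measurable M"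
begin

abbreviation "past i \<equiv> generated_algebra M {1..i} X"
abbreviation "present i \<equiv> generated_algebra M {i} X"

lemma subalgebra_X: "subalgebra M (generated_algebra M I X)"
  by (rule subalgebra_generated_algebra) (rule measurable_X)

lemma sigma_finite_X: "sigma_finite_subalgebra M (generated_algebra M I X)"
  by (rule sigma_finite_subalgebraI) (rule subalgebra_X)

text \<open>The Markov property read backwards in time: the future \<open>X (i + 1), \<dots>, X (i + n)\<close> adds nothing to
  what \<open>X i\<close> says about a past event. In this form the block grows at its end, so that the
  induction step needs the one-step Markov property at time \<open>i + n\<close> for events \<open>X (i + n + 1) \<in> B\<close>
  only: its conditional probability \<open>h\<close> is a function of \<open>X (i + n)\<close>, hence of the shorter block, to
  which the induction hypothesis applies.\<close>

theorem cond_exp_past_event_block: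
  assumes i: "i \<ge> 1" and S: "S \<in> sets (past i)"
  shows "AE \<omega> in M. real_cond_exp M (generated_algebra M {i..i + int n} X) (indicator S) \<omega>
    = real_cond_exp M (present i) (indicator S) \<omega>"
proof -
  have subM: "B \<in> sets M" if "B \<in> sets (generated_algebra M I X)" for B I
    using that subalgebra_X[of I] by (auto simp: subalgebra_def)
  have mono: "sets (generated_algebra M I X) \<subseteq> sets (generated_algebra M J X)" if "I \<subseteq> J" for I J
    using subalgebra_generated_algebra_mono[OF that, of M X] by (simp add: subalgebra_def)
  have mono_meas: "f \<in> borel_measurable (generated_algebra M J X)"
    if "f \<in> borel_measurable (generated_algebra M I X)" "I \<subseteq> J" for f :: "'a \<Rightarrow> real" and I J
    using measurable_from_subalg[OF subalgebra_generated_algebra_mono[OF that(2)] that(1)] .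
  have [measurable]: "S \<in> sets M" using S by (rule subM)
  define w where "w = real_cond_exp M (present i) (indicator S)"
  have w_bound: "AE \<omega> in M. \<bar>w \<omega>\<bar> \<le> 1"
    unfolding w_def by (rule abs_cond_exp_le[OF subalgebra_X]) (auto simp: indicator_def)
  have w_meas [measurable]: "w \<in> borel_measurable M" unfolding w_def by simp
  have int_w: "integrable M w"
    using w_meas w_bound by (rule integrable_bounded)
  have int_ind: "integrable M (indicator A :: 'a \<Rightarrow> real)" if "A \<in> sets M" for A
    using that by (intro integrable_bounded[of _ 1]) (auto simp: indicator_def)
  show ?thesis
    unfolding w_def[symmetric]
  proof (induction n)
    case 0
    show ?case by (simp add: w_def)
  next
    case (Suc n)
    let ?H = "generated_algebra M {i..i + int n} X"
    let ?H' = "generated_algebra M {i..i + int (Suc n)} X"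
    let ?l = "i + int n"
    \<comment> \<open>It suffices to test with these events, which generate the algebra of the longer block and are
      closed under intersection.\<close>
    define G where "G = {U \<inter> (X (?l + 1) -` B \<inter> space M) | U B. U \<in> sets ?H \<and> B \<in> sets borel}"
    have G_I: "U \<inter> (X (?l + 1) -` B \<inter> space M) \<in> G" if "U \<in> sets ?H" "B \<in> sets borel" for U B
      using that unfolding G_def by blast
    interpret P: sigma_finite_subalgebra M "past ?l" by (rule sigma_finite_X)
    interpret H: sigma_finite_subalgebra M ?H by (rule sigma_finite_X)
    interpret H': sigma_finite_subalgebra M ?H' by (rule sigma_finite_X)
    have X_in: "X (?l + 1) -` B \<inter> space M \<in> sets M" if "B \<in> sets borel" for B
      using measurable_sets[OF measurable_X that] .
    have "(\<integral>\<omega>\<in>E. indicat_real S \<omega> \<partial>M) = (\<integral>\<omega>\<in>E. w \<omega> \<partial>M)" if E_in: "E \<in> G" for E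
    proof -
      obtain U B where E: "E = U \<inter> (X (?l + 1) -` B \<inter> space M)" and U: "U \<in> sets ?H" and B: "B \<in> sets borel"
        using E_in unfolding G_def mem_Collect_eq by (elim exE conjE) (rule that)
      define V where "V = X (?l + 1) -` B \<inter> space M"
      have V [measurable]: "V \<in> sets M" unfolding V_def using B by (rule X_in)
      define h where "h = real_cond_exp M (present ?l) (indicator V)"
      have h_eq: "AE \<omega> in M. real_cond_exp M (past ?l) (indicator V) \<omega> = h \<omega>"
        using markov_chain i B unfolding markov_chain_def h_def V_def by auto
      have h_bound: "AE \<omega> in M. \<bar>h \<omega>\<bar> \<le> 1"
        unfolding h_def by (rule abs_cond_exp_le[OF subalgebra_X]) (auto simp: indicator_def)
      have [measurable]: "h \<in> borel_measurable M" unfolding h_def by simp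
      have h_H: "h \<in> borel_measurable ?H"
        unfolding h_def by (rule mono_meas[OF borel_measurable_cond_exp]) auto
      have [measurable]: "U \<in> sets M" using U by (rule subM)
      have U_past: "U \<in> sets (past ?l)"
        using U mono[of "{i..?l}" "{1..?l}"] i by auto
      have w_past: "w \<in> borel_measurable (past ?l)"
        unfolding w_def by (rule mono_meas[OF borel_measurable_cond_exp]) (use i in auto)
      have S_past: "S \<in> sets (past ?l)"
        using S mono[of "{1..i}" "{1..?l}"] by auto
      \<comment> \<open>Used twice, for the indicator of \<open>S\<close> and in the reverse direction for \<open>w\<close>: both are known at
        time \<open>i + n\<close>.\<close>
      have step: "(\<integral>\<omega>. (u \<omega> * indicator U \<omega>) * indicator V \<omega> \<partial>M) = (\<integral>\<omega>. (h \<omega> * indicator U \<omega>) * u \<omega> \<partial>M)"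
        if u: "u \<in> borel_measurable (past ?l)" and u_bound: "AE \<omega> in M. \<bar>u \<omega>\<bar> \<le> 1" for u :: "'a \<Rightarrow> real"
      proof -
        have [measurable]: "u \<in> borel_measurable M"
          using u by (rule measurable_from_subalg[OF subalgebra_X])
        have "integrable M (\<lambda>\<omega>. (u \<omega> * indicator U \<omega>) * indicator V \<omega>)"
          using u_bound by (intro integrable_bounded[of _ 1]) (auto simp: indicator_def)
        then have "(\<integral>\<omega>. (u \<omega> * indicator U \<omega>) * indicator V \<omega> \<partial>M)
            = (\<integral>\<omega>. (u \<omega> * indicator U \<omega>) * real_cond_exp M (past ?l) (indicator V) \<omega> \<partial>M)"
          by (intro P.real_cond_exp_intg(2)[symmetric] borel_measurable_times u
              borel_measurable_indicator U_past) auto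
        also have "\<dots> = (\<integral>\<omega>. (h \<omega> * indicator U \<omega>) * u \<omega> \<partial>M)"
          by (rule integral_cong_AE) (use h_eq in auto)
        finally show ?thesis .
      qed
      have "(\<integral>\<omega>\<in>E. indicat_real S \<omega> \<partial>M) = (\<integral>\<omega>. (indicat_real S \<omega> * indicator U \<omega>) * indicator V \<omega> \<partial>M)"
        unfolding set_lebesgue_integral_def E V_def[symmetric] by (simp add: indicator_inter_arith mult_ac)
      also have "\<dots> = (\<integral>\<omega>. (h \<omega> * indicator U \<omega>) * indicat_real S \<omega> \<partial>M)"
        by (rule step) (use S_past in \<open>auto simp: indicator_def\<close>)
      also have "\<dots> = (\<integral>\<omega>. (h \<omega> * indicator U \<omega>) * real_cond_exp M ?H (indicator S) \<omega> \<partial>M)"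
      proof (rule H.real_cond_exp_intg(2)[symmetric])
        show "integrable M (\<lambda>\<omega>. (h \<omega> * indicator U \<omega>) * indicat_real S \<omega>)"
          using h_bound by (intro integrable_bounded[of _ 1]) (auto simp: indicator_def)
      qed (use h_H U in auto)
      also have "\<dots> = (\<integral>\<omega>. (h \<omega> * indicator U \<omega>) * w \<omega> \<partial>M)"
        by (rule integral_cong_AE) (use Suc in auto)
      also have "\<dots> = (\<integral>\<omega>. (w \<omega> * indicator U \<omega>) * indicator V \<omega> \<partial>M)"
        by (rule step[symmetric]) (use w_past w_bound in auto)
      also have "\<dots> = (\<integral>\<omega>\<in>E. w \<omega> \<partial>M)"
        unfolding set_lebesgue_integral_def E V_def[symmetric] by (simp add: indicator_inter_arith mult_ac)
      finally show ?thesis .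
    qed
    moreover have "Int_stable G"
    proof (rule Int_stableI)
      fix a b assume "a \<in> G" "b \<in> G"
      then obtain U B U' B' where ab: "a = U \<inter> (X (?l + 1) -` B \<inter> space M)"
        "b = U' \<inter> (X (?l + 1) -` B' \<inter> space M)"
        and UB: "U \<in> sets ?H" "B \<in> sets borel" "U' \<in> sets ?H" "B' \<in> sets borel"
        unfolding G_def by blast
      have "a \<inter> b = (U \<inter> U') \<inter> (X (?l + 1) -` (B \<inter> B') \<inter> space M)"
        by (auto simp: ab)
      also have "\<dots> \<in> G"
        using UB by (intro G_I) auto
      finally show "a \<inter> b \<in> G" .
    qed
    moreover have "G \<subseteq> sets M"
    proof
      fix E assume "E \<in> G"
      then obtain U B where "E = U \<inter> (X (?l + 1) -` B \<inter> space M)" "U \<in> sets ?H" "B \<in> sets borel"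
        unfolding G_def by blast
      then show "E \<in> sets M"
        using sets.Int[OF subM X_in] by simp
    qed
    moreover have "space M \<in> G"
      using G_I[of "space M" UNIV] sets.top[of ?H] by simp
    moreover have "sets ?H' \<subseteq> sigma_sets (space M) G"
    proof -
      let ?N = "sigma (space M) G"
      have G_Pow: "G \<subseteq> Pow (space M)" by (auto simp: G_def)
      have "sets ?H' \<subseteq> sets ?N"
      proof (rule sets_generated_algebra_subset)
        fix k assume k: "k \<in> {i..i + int (Suc n)}"
        show "X k \<in> borel_measurable ?N"
        proof (rule measurableI)
          fix B :: "'b set" assume B: "B \<in> sets borel"
          have "X k -` B \<inter> space M \<in> G"
          proof (cases "k = ?l + 1")
            case True
            then show ?thesis
              using G_I[of "space M" B] sets.top[of ?H] B by (simp add: Int_ac)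
          next
            case False
            then have "X k -` B \<inter> space M \<in> sets ?H"
              using measurable_sets[OF measurable_generated_algebra[of k "{i..?l}" X M] B] k by auto
            then show ?thesis
              using G_I[of "X k -` B \<inter> space M" UNIV] by simp
          qed
          then show "X k -` B \<inter> space ?N \<in> sets ?N"
            using G_Pow by (simp add: space_measure_of sets_measure_of)
        qed simp
      qed (simp add: space_measure_of G_Pow)
      then show ?thesis using G_Pow by simp
    qed
    ultimately have eq: "(\<integral>\<omega>\<in>E. indicat_real S \<omega> \<partial>M) = (\<integral>\<omega>\<in>E. w \<omega> \<partial>M)" if "E \<in> sets ?H'" for E
      using that int_w int_ind[OF \<open>S \<in> sets M\<close>]
      by (intro integral_eq_on_generated_sigma_algebra[of "indicator S" w G E]) auto
    show ?case
    proof (rule H'.real_cond_exp_charact[OF eq])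
      show "w \<in> borel_measurable ?H'"
        unfolding w_def by (rule mono_meas[OF borel_measurable_cond_exp]) auto
    qed (use int_w int_ind in auto)
  qed
qed

text \<open>A bound on the conditional expectation given the present extends to the whole past. With \<open>w\<close>
  the conditional probability of \<open>S\<close> given \<open>X i\<close>, the theorem replaces the indicator of \<open>S\<close> by
  \<open>w\<close>, and against functions of \<open>X i\<close> the assumed bound can be used.\<close>

corollary integral_past_event_le:
  assumes i: "i \<ge> 1" and S: "S \<in> sets (past i)"
    and f: "f \<in> borel_measurable (generated_algebra M {i..i + int n} X)"
    and bound: "AE \<omega> in M. \<bar>f \<omega>\<bar> \<le> B"
    and le: "AE \<omega> in M. real_cond_exp M (present i) f \<omega> \<le> c"
  shows "(\<integral>\<omega>\<in>S. f \<omega> \<partial>M) \<le> c * measure M S"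
proof -
  let ?H = "generated_algebra M {i..i + int n} X"
  interpret P: sigma_finite_subalgebra M "present i" by (rule sigma_finite_X)
  interpret H: sigma_finite_subalgebra M ?H by (rule sigma_finite_X)
  have [measurable]: "S \<in> sets M"
    using S subalgebra_X by (auto simp: subalgebra_def)
  have [measurable]: "f \<in> borel_measurable M"
    using f by (rule measurable_from_subalg[OF subalgebra_X])
  define w where "w = real_cond_exp M (present i) (indicator S)"
  have [measurable]: "w \<in> borel_measurable M" unfolding w_def by simp
  have int_S: "integrable M (indicator S :: 'a \<Rightarrow> real)"
    by (intro integrable_bounded[of _ 1]) (auto simp: indicator_def)
  have w_bound: "AE \<omega> in M. \<bar>w \<omega>\<bar> \<le> 1"
    unfolding w_def by (rule abs_cond_exp_le[OF subalgebra_X]) (auto simp: indicator_def)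
  have w_nonneg: "AE \<omega> in M. 0 \<le> w \<omega>"
    unfolding w_def by (rule P.real_cond_exp_pos) auto
  have int_w: "integrable M w" "(\<integral>\<omega>. w \<omega> \<partial>M) = measure M S"
    using P.real_cond_exp_int[OF int_S] by (simp_all add: w_def)
  have int_f: "integrable M f"
    using bound by (intro integrable_bounded) auto
  have int_wf: "integrable M (\<lambda>\<omega>. w \<omega> * f \<omega>)"
  proof (rule integrable_bounded)
    show "AE \<omega> in M. \<bar>w \<omega> * f \<omega>\<bar> \<le> 1 * B"
      using w_bound bound
    proof eventually_elim
      case (elim \<omega>)
      then show ?case unfolding abs_mult by (intro mult_mono) auto
    qed
  qed auto
  have "(\<integral>\<omega>\<in>S. f \<omega> \<partial>M) = (\<integral>\<omega>. f \<omega> * indicat_real S \<omega> \<partial>M)"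
    unfolding set_lebesgue_integral_def by (simp add: mult.commute)
  also have "\<dots> = (\<integral>\<omega>. f \<omega> * real_cond_exp M ?H (indicator S) \<omega> \<partial>M)"
  proof (rule H.real_cond_exp_intg(2)[symmetric])
    show "integrable M (\<lambda>\<omega>. f \<omega> * indicat_real S \<omega>)"
      using integrable_mult_indicator[OF \<open>S \<in> sets M\<close> int_f] by (simp add: mult.commute)
  qed (use f in auto)
  also have "\<dots> = (\<integral>\<omega>. w \<omega> * f \<omega> \<partial>M)"
    by (rule integral_cong_AE)
      (use cond_exp_past_event_block[OF i S, of n] in \<open>auto simp: w_def\<close>)
  also have "\<dots> = (\<integral>\<omega>. w \<omega> * real_cond_exp M (present i) f \<omega> \<partial>M)"
    by (rule P.real_cond_exp_intg(2)[symmetric]) (use int_wf in \<open>auto simp: w_def\<close>)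
  also have "\<dots> \<le> (\<integral>\<omega>. w \<omega> * c \<partial>M)"
  proof (rule integral_mono_AE)
    show "integrable M (\<lambda>\<omega>. w \<omega> * real_cond_exp M (present i) f \<omega>)"
      by (rule P.real_cond_exp_intg(1)) (use int_wf in \<open>auto simp: w_def\<close>)
    show "AE \<omega> in M. w \<omega> * real_cond_exp M (present i) f \<omega> \<le> w \<omega> * c"
      using w_nonneg le by eventually_elim (auto intro: mult_left_mono)
  qed (use int_w in auto)
  also have "\<dots> = c * measure M S"
    by (simp add: int_w)
  finally show ?thesis .
qed

end

section \<open>Freezing variables that are known from the past\<close>

text \<open>An inequality known for each fixed \<open>z\<close> on all events of \<open>F\<close> remains true for an \<open>F\<close>-measurable
  random \<open>Z\<close> in place of \<open>z\<close>. For \<open>Z\<close> with finitely many values one splits according to the value,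
  and the general case follows by dominated convergence,
  since \<open>q\<close> is continuous in \<open>z\<close>.\<close>

lemma (in finite_measure) integral_freeze_le_0:
  fixes Z :: "'a \<Rightarrow> 'c::{metric_space, second_countable_topology}" and q :: "'a \<Rightarrow> 'c \<Rightarrow> real"
  assumes F: "subalgebra M F" and Z: "Z \<in> borel_measurable F" "\<And>\<omega>. \<omega> \<in> space M \<Longrightarrow> Z \<omega> \<in> U"
    and U: "open U"
    and q_meas: "\<And>z. z \<in> U \<Longrightarrow> (\<lambda>\<omega>. q \<omega> z) \<in> borel_measurable M"
    and qZ_meas: "(\<lambda>\<omega>. q \<omega> (Z \<omega>)) \<in> borel_measurable M"
    and q_bound: "\<And>\<omega> z. \<bar>q \<omega> z\<bar> \<le> B"
    and q_cont: "\<And>\<omega>. \<omega> \<in> space M \<Longrightarrow> continuous_on U (q \<omega>)"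
    and le: "\<And>z S. z \<in> U \<Longrightarrow> S \<in> sets F \<Longrightarrow> (\<integral>\<omega>\<in>S. q \<omega> z \<partial>M) \<le> 0"
  shows "(\<integral>\<omega>. q \<omega> (Z \<omega>) \<partial>M) \<le> 0"
proof -
  have space_F: "space F = space M" and sets_F: "sets F \<subseteq> sets M"
    using F by (auto simp: subalgebra_def)
  obtain s where s: "\<And>i. simple_function F (s i)"
    and s_lim: "\<And>\<omega>. \<omega> \<in> space M \<Longrightarrow> (\<lambda>i. s i \<omega>) \<longlonglongrightarrow> Z \<omega>"
    using borel_measurable_implies_sequence_metric[OF Z(1)] space_F by metis
  \<comment> \<open>The approximations may leave \<open>U\<close>, but at each point only finitely often; these values are cut off.\<close>
  define f where "f i \<omega> = indicator U (s i \<omega>) * q \<omega> (s i \<omega>)" for i \<omega>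
  define A where "A i z = s i -` {z} \<inter> space M" for i z
  have A: "A i z \<in> sets F" for i z
    using simple_functionD(2)[OF s[of i], of "{z}"] by (simp add: A_def space_F)
  define R where "R i = s i ` space M \<inter> U" for i
  have fin: "finite (R i)" for i
    using simple_functionD(1)[OF s[of i]] by (simp add: R_def space_F)
  have f_sum: "f i \<omega> = (\<Sum>z\<in>R i. indicator (A i z) \<omega> * q \<omega> z)" if "\<omega> \<in> space M" for i \<omega>
  proof -
    have "(\<Sum>z\<in>R i. indicator (A i z) \<omega> * q \<omega> z) = (\<Sum>z\<in>R i. if z = s i \<omega> then q \<omega> z else 0)"
      using that by (intro sum.cong) (auto simp: A_def)
    also have "\<dots> = f i \<omega>"
      using that fin[of i] by (auto simp: f_def R_def)
    finally show ?thesis ..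
  qed
  have B: "0 \<le> B"
    using q_bound[of undefined undefined] by linarith
  have int_A: "integrable M (\<lambda>\<omega>. indicator (A i z) \<omega> * q \<omega> z)" if "z \<in> U" for i z
  proof -
    have [measurable]: "A i z \<in> sets M" "(\<lambda>\<omega>. q \<omega> z) \<in> borel_measurable M"
      using A sets_F q_meas[OF that] by auto
    show ?thesis
      by (rule integrable_const_bound[of _ B]) (use q_bound B in \<open>auto simp: indicator_def\<close>)
  qed
  have "(\<lambda>i. \<integral>\<omega>. f i \<omega> \<partial>M) \<longlonglongrightarrow> (\<integral>\<omega>. q \<omega> (Z \<omega>) \<partial>M)"
  proof (rule integral_dominated_convergence[where w = "\<lambda>_. B"])
    show "f i \<in> borel_measurable M" for i
    proof -
      have "(\<lambda>\<omega>. \<Sum>z\<in>R i. indicator (A i z) \<omega> * q \<omega> z) \<in> borel_measurable M"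
        using int_A by (intro borel_measurable_sum borel_measurable_integrable) (auto simp: R_def)
      then show ?thesis
        using f_sum measurable_cong[of M "f i"] by auto
    qed
    show "AE \<omega> in M. (\<lambda>i. f i \<omega>) \<longlonglongrightarrow> q \<omega> (Z \<omega>)"
    proof (rule AE_I2)
      fix \<omega> assume \<omega>: "\<omega> \<in> space M"
      have ev: "eventually (\<lambda>i. s i \<omega> \<in> U) sequentially"
        using s_lim[OF \<omega>] U Z(2)[OF \<omega>] by (rule topological_tendstoD)
      have "isCont (q \<omega>) (Z \<omega>)"
        using q_cont[OF \<omega>] U Z(2)[OF \<omega>] by (simp add: continuous_on_eq_continuous_at)
      then have "(\<lambda>i. q \<omega> (s i \<omega>)) \<longlonglongrightarrow> q \<omega> (Z \<omega>)"
        using s_lim[OF \<omega>] by (rule isCont_tendsto_compose)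
      then show "(\<lambda>i. f i \<omega>) \<longlonglongrightarrow> q \<omega> (Z \<omega>)"
        by (rule Lim_transform_eventually)
          (use ev in eventually_elim, auto simp: f_def)
    qed
    show "AE \<omega> in M. norm (f i \<omega>) \<le> B" for i
      using q_bound B by (auto simp: f_def indicator_def)
  qed (use qZ_meas in auto)
  moreover have "(\<integral>\<omega>. f i \<omega> \<partial>M) \<le> 0" for i
  proof -
    have "(\<integral>\<omega>. f i \<omega> \<partial>M) = (\<integral>\<omega>. (\<Sum>z\<in>R i. indicator (A i z) \<omega> * q \<omega> z) \<partial>M)"
      by (rule Bochner_Integration.integral_cong) (auto simp: f_sum)
    also have "\<dots> = (\<Sum>z\<in>R i. \<integral>\<omega>. indicator (A i z) \<omega> * q \<omega> z \<partial>M)"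
      by (rule Bochner_Integration.integral_sum) (auto simp: R_def intro: int_A)
    also have "\<dots> \<le> 0"
      using le[OF _ A] by (intro sum_nonpos) (auto simp: R_def set_lebesgue_integral_def)
    finally show ?thesis .
  qed
  ultimately show ?thesis
    by (intro LIMSEQ_le_const2) auto
qed

section \<open>Contraction of the projective action in mean\<close>

lemma exp_le_quadratic:
  fixes u :: real
  assumes "\<bar>u\<bar> \<le> 1"
  shows "exp u \<le> 1 + u + u\<^sup>2"
proof (cases "u \<ge> 0")
  case True
  then show ?thesis using assms by (intro exp_bound) auto
next
  case False
  define v where "v = - u"
  have v: "0 < v" using False by (simp add: v_def)
  have "1 \<le> (1 + v) * (1 - v + v\<^sup>2)"
    using v by (simp add: algebra_simps power2_eq_square)
  moreover have "1 + v \<le> exp v" by (rule exp_ge_add_one_self)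
  moreover have "0 \<le> 1 - v + v\<^sup>2"
    using assms by (auto simp: v_def)
  ultimately have "1 \<le> exp v * (1 - v + v\<^sup>2)"
    by (meson mult_right_mono order_trans)
  then show ?thesis
    by (simp add: v_def exp_minus divide_simps mult.commute)
qed

text \<open>The drift hypothesis is stated with vectors, and with the present at time \<open>i \<ge> 1\<close>, so that the block
  starts at time \<open>i + 1\<close>. The condition on \<open>wedge_norm\<close> says that the two lines are distinct.\<close>

locale contracting_chain = markov_process M g
  for M :: "'a measure" and g :: "int \<Rightarrow> 'a \<Rightarrow> real^'n^'n" +
  fixes c \<delta> :: real and n\<^sub>0 :: nat
  assumes invertible_g: "\<And>i \<omega>. i \<ge> 1 \<Longrightarrow> \<omega> \<in> space M \<Longrightarrow> invertible (g i \<omega>)"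
    and c_ge_1: "c \<ge> 1"
    and distortion_g: "AE \<omega> in M. \<forall>i\<ge>1. distortion_le c (g i \<omega>)"
    and delta_pos: "\<delta> > 0" and n\<^sub>0_pos: "n\<^sub>0 > 0"
    and drift: "\<And>i x y. i \<ge> 1 \<Longrightarrow> wedge_norm x y \<noteq> 0 \<Longrightarrow>
      AE \<omega> in M. real_cond_exp M (generated_algebra M {i} g) (\<lambda>\<omega>. ln (line_dist
        (chain_product g (i + 1) n\<^sub>0 \<omega> *v x) (chain_product g (i + 1) n\<^sub>0 \<omega> *v y) / line_dist x y)) \<omega>
        \<le> - \<delta>"
begin

lemma measurable_chain_product_generated:
  "{j..<j + int n} \<subseteq> I \<Longrightarrow> chain_product g j n \<in> borel_measurable (generated_algebra M I g)"
  by (intro borel_measurable_chain_product measurable_generated_algebra) auto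

lemma measurable_chain_product [measurable]: "chain_product g j n \<in> borel_measurable M"
  by (rule borel_measurable_chain_product) simp

lemma chain_product_nonzero:
  "j \<ge> 1 \<Longrightarrow> \<omega> \<in> space M \<Longrightarrow> x \<noteq> 0 \<Longrightarrow> chain_product g j n \<omega> *v x \<noteq> 0"
  by (intro invertible_mult_vector_nonzero invertible_chain_product invertible_g) auto

text \<open>In \<open>n\<^sub>0\<close> steps, the logarithm of a distance changes by at most \<open>4 ln (c ^ n\<^sub>0)\<close>. The summand \<open>1\<close> keeps
  the bound positive, as it will be a denominator.\<close>

definition log_bound :: real where
  "log_bound = 1 + 4 * ln (c ^ n\<^sub>0)"

text \<open>With \<open>L = log_bound\<close> and a logarithm of the ratio whose mean is at most \<open>-\<delta>\<close>, the \<open>s\<close>-th power of the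
  ratio has mean at most \<open>1 - s \<delta> + s\<^sup>2 L\<^sup>2\<close>, provided that \<open>s L \<le> 1\<close>. The bound \<open>s \<le> \<delta> / (2 L\<^sup>2)\<close> makes this at
  most \<open>1 - s \<delta> / 2\<close>, and \<open>s \<le> 1 / \<delta>\<close> makes the latter positive.
  With \<open>s \<le> 1\<close>, a distance is at most its \<open>s\<close>-th power.\<close>

definition exponent :: real where
  "exponent = min 1 (min (1 / log_bound) (min (\<delta> / (2 * log_bound\<^sup>2)) (1 / \<delta>)))"

definition rate :: real where
  "rate = 1 - exponent * \<delta> / 2"

lemma log_bound_ge_1: "log_bound \<ge> 1"
  using c_ge_1 by (simp add: log_bound_def)

lemma exponent_bounds:
  "0 < exponent" "exponent \<le> 1" "exponent * log_bound \<le> 1" "exponent * log_bound\<^sup>2 \<le> \<delta> / 2"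
  "exponent * \<delta> \<le> 1"
proof -
  have pos: "0 < log_bound" using log_bound_ge_1 by simp
  then show "0 < exponent" using delta_pos by (simp add: exponent_def)
  show "exponent \<le> 1" by (simp add: exponent_def)
  have "exponent \<le> 1 / log_bound" "exponent \<le> \<delta> / (2 * log_bound\<^sup>2)" "exponent \<le> 1 / \<delta>"
    by (simp_all add: exponent_def)
  then show "exponent * log_bound \<le> 1" "exponent * log_bound\<^sup>2 \<le> \<delta> / 2" "exponent * \<delta> \<le> 1"
    using pos delta_pos by (simp_all add: field_simps)
qed

lemma rate_bounds: "0 < rate" "rate < 1"
  using exponent_bounds(1,5) delta_pos by (auto simp: rate_def)

lemma line_dist_powr_exponent_le_1: "line_dist u v powr exponent \<le> 1" for u v :: "real^'n"
  using exponent_bounds(1) by (intro powr_le1) (auto simp: line_dist_le_1)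

text \<open>Contraction for fixed lines, in the form that freezing requires. By the quadratic
  bound on \<open>exp\<close>, the integrand is at most a positive constant times \<open>R + \<delta>\<close>, where \<open>R\<close> is the logarithm of the
  ratio of the distances, and the drift bounds the integral of \<open>R\<close> over any past event. When the
  two lines coincide there is no ratio, but both distances vanish.\<close>

lemma line_dist_powr_contracts_on_past_event:
  assumes i: "i \<ge> 1" and S: "S \<in> sets (past i)" and nz: "x \<noteq> 0" "y \<noteq> 0"
  shows "(\<integral>\<omega>\<in>S. line_dist (chain_product g (i + 1) n\<^sub>0 \<omega> *v x) (chain_product g (i + 1) n\<^sub>0 \<omega> *v y)
      powr exponent - rate * line_dist x y powr exponent \<partial>M) \<le> 0"
proof -
  let ?P = "chain_product g (i + 1) n\<^sub>0"
  let ?q = "\<lambda>\<omega>. line_dist (?P \<omega> *v x) (?P \<omega> *v y) powr exponent - rate * line_dist x y powr exponent"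
  have P: "AE \<omega> in M. distortion_le (c ^ n\<^sub>0) (?P \<omega>)"
    using distortion_g
    by eventually_elim (use i c_ge_1 in \<open>auto intro!: distortion_le_chain_product\<close>)
  have [measurable]: "S \<in> sets M"
    using S subalgebra_X by (auto simp: subalgebra_def)
  have c': "c ^ n\<^sub>0 \<ge> 1" using c_ge_1 by simp
  show ?thesis
  proof (cases "wedge_norm x y = 0")
    case True
    have "AE \<omega> in M. indicator S \<omega> *\<^sub>R ?q \<omega> = 0"
      using P
    proof eventually_elim
      case (elim \<omega>)
      have "wedge_norm (?P \<omega> *v x) (?P \<omega> *v y) \<le> 0"
        using wedge_norm_matrix_le(1)[OF elim, of x y] c' True by simp
      then have "wedge_norm (?P \<omega> *v x) (?P \<omega> *v y) = 0"
        using wedge_norm_nonneg by (rule antisym)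
      then show ?case using True by (simp add: line_dist_def)
    qed
    then have "(\<integral>\<omega>\<in>S. ?q \<omega> \<partial>M) = (\<integral>\<omega>. 0 \<partial>M)"
      unfolding set_lebesgue_integral_def by (intro integral_cong_AE) auto
    then show ?thesis by simp
  next
    case False
    define R where "R \<omega> = ln (line_dist (?P \<omega> *v x) (?P \<omega> *v y) / line_dist x y)" for \<omega>
    define d where "d = line_dist x y"
    have d: "d > 0"
      using False nz wedge_norm_nonneg[of x y] by (simp add: d_def line_dist_def less_le)
    have [measurable]: "R \<in> borel_measurable M"
      unfolding R_def[abs_def] by measurable
    have R_bound: "AE \<omega> in M. \<bar>R \<omega>\<bar> \<le> log_bound"
      using P
    proof eventually_elim
      case (elim \<omega>)
      then show ?case
        unfolding R_def log_bound_def using abs_ln_line_dist_ratio_le[OF elim c' False] by linarith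
    qed
    have R_le: "(\<integral>\<omega>\<in>S. R \<omega> \<partial>M) \<le> - \<delta> * measure M S"
    proof (rule integral_past_event_le[OF i S _ R_bound])
      have [measurable]: "?P \<in> borel_measurable (generated_algebra M {i..i + int n\<^sub>0} g)"
        by (rule measurable_chain_product_generated) auto
      show "R \<in> borel_measurable (generated_algebra M {i..i + int n\<^sub>0} g)"
        unfolding R_def[abs_def] by measurable
      show "AE \<omega> in M. real_cond_exp M (present i) R \<omega> \<le> - \<delta>"
        using drift[OF i False] by (simp add: R_def[abs_def])
    qed
    have int_R: "set_integrable M S R" "set_integrable M S (\<lambda>_. \<delta>)"
      unfolding set_integrable_def using R_bound
      by (auto intro!: integrable_mult_indicator[OF \<open>S \<in> sets M\<close>] integrable_bounded simp del: real_scaleR_def)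
    have "(\<integral>\<omega>\<in>S. ?q \<omega> \<partial>M) \<le> (\<integral>\<omega>\<in>S. d powr exponent * exponent * (R \<omega> + \<delta>) \<partial>M)"
    proof (rule set_integral_mono_AE)
      show "set_integrable M S (\<lambda>\<omega>. d powr exponent * exponent * (R \<omega> + \<delta>))"
        by (intro set_integrable_mult_right set_integral_add int_R)
      show "set_integrable M S ?q"
      proof -
        have "integrable M ?q"
          using line_dist_powr_exponent_le_1
          by (intro Bochner_Integration.integrable_diff integrable_const integrable_bounded[of _ 1]) auto
        then show ?thesis
          unfolding set_integrable_def by (rule integrable_mult_indicator[OF \<open>S \<in> sets M\<close>])
      qed
      show "AE \<omega>\<in>S in M. ?q \<omega> \<le> d powr exponent * exponent * (R \<omega> + \<delta>)"
        using P R_bound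
      proof eventually_elim
        case (elim \<omega>)
        define D where "D = line_dist (?P \<omega> *v x) (?P \<omega> *v y)"
        have "D > 0"
        proof -
          have "wedge_norm (?P \<omega> *v x) (?P \<omega> *v y) \<noteq> 0"
          proof
            assume "wedge_norm (?P \<omega> *v x) (?P \<omega> *v y) = 0"
            then have "wedge_norm x y \<le> 0"
              using wedge_norm_matrix_le(2)[OF elim(1), of x y] c' by simp
            then show False using False wedge_norm_nonneg[of x y] by linarith
          qed
          then show ?thesis
            using wedge_norm_nonneg[of "?P \<omega> *v x" "?P \<omega> *v y"] distortion_le_pos(2)[OF elim(1)] nz
            by (simp add: D_def line_dist_def less_le)
        qed
        then have "ln D = ln d + R \<omega>"
          unfolding R_def D_def[symmetric] d_def[symmetric] using d by (simp add: ln_div)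
        then have "D powr exponent = d powr exponent * exp (exponent * R \<omega>)"
          using d \<open>D > 0\<close> by (simp add: powr_def distrib_left exp_add)
        moreover have "exp (exponent * R \<omega>) - rate \<le> exponent * (R \<omega> + \<delta>)"
        proof -
          have "\<bar>exponent * R \<omega>\<bar> \<le> exponent * log_bound"
            using exponent_bounds(1) elim(2) by (simp add: abs_mult)
          then have "exp (exponent * R \<omega>) \<le> 1 + exponent * R \<omega> + (exponent * R \<omega>)\<^sup>2"
            using exponent_bounds(3) by (intro exp_le_quadratic) linarith
          moreover have "(exponent * R \<omega>)\<^sup>2 \<le> exponent * (exponent * log_bound\<^sup>2)"
          proof -
            have "(R \<omega>)\<^sup>2 \<le> log_bound\<^sup>2"
              using elim(2) log_bound_ge_1 by (simp add: abs_le_square_iff[symmetric])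
            then show ?thesis
              using exponent_bounds(1) by (simp add: power_mult_distrib power2_eq_square)
          qed
          moreover have "exponent * (exponent * log_bound\<^sup>2) \<le> exponent * (\<delta> / 2)"
            using exponent_bounds(1,4) by (intro mult_left_mono) auto
          ultimately show ?thesis
            by (simp add: rate_def algebra_simps)
        qed
        then have "d powr exponent * (exp (exponent * R \<omega>) - rate) \<le> d powr exponent * (exponent * (R \<omega> + \<delta>))"
          by (intro mult_left_mono) auto
        ultimately have "D powr exponent - rate * d powr exponent \<le> d powr exponent * exponent * (R \<omega> + \<delta>)"
          by (simp add: algebra_simps)
        then show ?case
          unfolding D_def[symmetric] d_def[symmetric] by simp
      qed
    qed
    also have "\<dots> = d powr exponent * exponent * ((\<integral>\<omega>\<in>S. R \<omega> \<partial>M) + (\<integral>\<omega>\<in>S. \<delta> \<partial>M))"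
      by (simp add: set_integral_add(2)[OF int_R])
    also have "\<dots> \<le> 0"
    proof -
      have "(\<integral>\<omega>\<in>S. \<delta> \<partial>M) = \<delta> * measure M S"
        by (simp add: set_lebesgue_integral_def mult.commute)
      then show ?thesis
        using R_le exponent_bounds(1) by (intro mult_nonneg_nonpos) auto
    qed
    finally show ?thesis .
  qed
qed

text \<open>Freezing is applied to the difference of the two powers rather than to their ratio: the difference is
  bounded everywhere, and it is continuous also where the two lines coincide.\<close>

lemma expectation_line_dist_powr_contracts:
  assumes i: "i \<ge> 1"
    and x: "x \<in> borel_measurable (past i)" "\<And>\<omega>. \<omega> \<in> space M \<Longrightarrow> x \<omega> \<noteq> 0"
    and y: "y \<in> borel_measurable (past i)" "\<And>\<omega>. \<omega> \<in> space M \<Longrightarrow> y \<omega> \<noteq> 0"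
  shows "(\<integral>\<omega>. line_dist (chain_product g (i + 1) n\<^sub>0 \<omega> *v x \<omega>) (chain_product g (i + 1) n\<^sub>0 \<omega> *v y \<omega>)
      powr exponent \<partial>M) \<le> rate * (\<integral>\<omega>. line_dist (x \<omega>) (y \<omega>) powr exponent \<partial>M)"
proof -
  let ?P = "chain_product g (i + 1) n\<^sub>0"
  have [measurable]: "x \<in> borel_measurable M" "y \<in> borel_measurable M"
    using x(1) y(1) by (auto intro: measurable_from_subalg[OF subalgebra_X])
  define q where "q \<omega> z = line_dist (?P \<omega> *v fst z) (?P \<omega> *v snd z) powr exponent
    - rate * line_dist (fst z) (snd z) powr exponent" for \<omega> and z :: "(real^'n) \<times> (real^'n)"
  define U :: "((real^'n) \<times> (real^'n)) set" where "U = {z. fst z \<noteq> 0 \<and> snd z \<noteq> 0}"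
  have U_eq: "U = (- {0}) \<times> (- {0})" by (auto simp: U_def)
  have "(\<integral>\<omega>. q \<omega> (x \<omega>, y \<omega>) \<partial>M) \<le> 0"
  proof (rule integral_freeze_le_0[OF subalgebra_X[of "{1..i}"],
        where Z = "\<lambda>\<omega>. (x \<omega>, y \<omega>)" and q = q and U = U and B = 1])
    show "(\<lambda>\<omega>. (x \<omega>, y \<omega>)) \<in> borel_measurable (past i)"
      using x(1) y(1) by (rule borel_measurable_Pair)
    show "(x \<omega>, y \<omega>) \<in> U" if "\<omega> \<in> space M" for \<omega>
      using x(2) y(2) that by (simp add: U_def)
    show "open U" unfolding U_eq by (intro open_Times) auto
    show "\<bar>q \<omega> z\<bar> \<le> 1" for \<omega> z
    proof -
      have "0 \<le> rate * line_dist (fst z) (snd z) powr exponent"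
        using rate_bounds by simp
      moreover have "rate * line_dist (fst z) (snd z) powr exponent \<le> 1 * 1"
        using rate_bounds by (intro mult_mono line_dist_powr_exponent_le_1) auto
      ultimately show ?thesis
        using line_dist_powr_exponent_le_1[of "?P \<omega> *v fst z" "?P \<omega> *v snd z"] unfolding q_def
        by (smt (verit) powr_ge_zero)
    qed
    show "continuous_on U (q \<omega>)" if "\<omega> \<in> space M" for \<omega>
    proof -
      have ld: "continuous_on U (\<lambda>z. line_dist (A *v fst z) (A *v snd z) powr exponent)"
        if A: "\<And>v. v \<noteq> 0 \<Longrightarrow> A *v v \<noteq> 0" for A :: "real^'n^'n"
      proof (rule continuous_on_powr')
        show "continuous_on U (\<lambda>z. line_dist (A *v fst z) (A *v snd z))"
          using A unfolding line_dist_def wedge_norm_eq_sqrt U_def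
          by (intro continuous_intros linear_continuous_on_compose[where f = fst]
              linear_continuous_on_compose[where f = snd] matrix_vector_mul_linear) auto
      qed (use exponent_bounds(1) in auto)
      from ld[of "mat 1"] ld[OF chain_product_nonzero[of "i + 1" \<omega>]] i that show ?thesis
        unfolding q_def by (auto intro!: continuous_on_diff continuous_on_mult_left)
    qed
    show "(\<integral>\<omega>\<in>S. q \<omega> z \<partial>M) \<le> 0" if "z \<in> U" "S \<in> sets (past i)" for z S
      using line_dist_powr_contracts_on_past_event[OF i that(2)] that(1) by (simp add: q_def U_def)
    show "(\<lambda>\<omega>. q \<omega> z) \<in> borel_measurable M" for z
      unfolding q_def by measurable
    show "(\<lambda>\<omega>. q \<omega> (x \<omega>, y \<omega>)) \<in> borel_measurable M"
      unfolding q_def fst_conv snd_conv by measurable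
  qed
  moreover have "integrable M (\<lambda>\<omega>. line_dist (u \<omega>) (v \<omega>) powr exponent)"
    if [measurable]: "u \<in> borel_measurable M" "v \<in> borel_measurable M" for u v :: "'a \<Rightarrow> real^'n"
    using line_dist_powr_exponent_le_1 by (intro integrable_bounded[of _ 1]) auto
  ultimately show ?thesis
    unfolding q_def by simp
qed

lemma expectation_line_dist_powr_decay:
  assumes i: "i \<ge> 1"
    and x: "x \<in> borel_measurable (past i)" "\<And>\<omega>. \<omega> \<in> space M \<Longrightarrow> x \<omega> \<noteq> 0"
    and y: "y \<in> borel_measurable (past i)" "\<And>\<omega>. \<omega> \<in> space M \<Longrightarrow> y \<omega> \<noteq> 0"
  shows "(\<integral>\<omega>. line_dist (chain_product g (i + 1) (n\<^sub>0 * m) \<omega> *v x \<omega>)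
      (chain_product g (i + 1) (n\<^sub>0 * m) \<omega> *v y \<omega>) powr exponent \<partial>M) \<le> rate ^ m"
proof (induction m)
  case 0
  have [measurable]: "x \<in> borel_measurable M" "y \<in> borel_measurable M"
    using x(1) y(1) by (auto intro: measurable_from_subalg[OF subalgebra_X])
  have "(\<integral>\<omega>. line_dist (x \<omega>) (y \<omega>) powr exponent \<partial>M) \<le> (\<integral>\<omega>. 1 \<partial>M)"
    using line_dist_powr_exponent_le_1 by (intro integral_mono integrable_bounded[of _ 1]) auto
  then show ?case by (simp add: prob_space)
next
  case (Suc m)
  let ?i = "i + int (n\<^sub>0 * m)"
  have i': "?i \<ge> 1" using i of_nat_0_le_iff[of "n\<^sub>0 * m"] by linarith
  define u where "u z \<omega> = chain_product g (i + 1) (n\<^sub>0 * m) \<omega> *v z \<omega>" for z :: "'a \<Rightarrow> real^'n" and \<omega>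
  have u: "u z \<in> borel_measurable (past ?i)" if "z \<in> borel_measurable (past i)" for z
    unfolding u_def[abs_def]
  proof (intro borel_measurable_matrix_vector_mult)
    show "chain_product g (i + 1) (n\<^sub>0 * m) \<in> borel_measurable (past ?i)"
      using i by (intro measurable_chain_product_generated) auto
    show "z \<in> borel_measurable (past ?i)"
      by (rule measurable_from_subalg[OF subalgebra_generated_algebra_mono that]) auto
  qed
  have u_nz: "u z \<omega> \<noteq> 0" if "\<omega> \<in> space M" "z \<omega> \<noteq> 0" for z \<omega>
    unfolding u_def using i that by (intro chain_product_nonzero) auto
  have split: "chain_product g (i + 1) (n\<^sub>0 * Suc m) \<omega> *v z \<omega> = chain_product g (?i + 1) n\<^sub>0 \<omega> *v u z \<omega>" for z \<omega>
    using chain_product_add[of g "i + 1" "n\<^sub>0 * m" n\<^sub>0 \<omega>]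
    by (simp add: u_def matrix_vector_mul_assoc add_ac)
  have "(\<integral>\<omega>. line_dist (chain_product g (?i + 1) n\<^sub>0 \<omega> *v u x \<omega>) (chain_product g (?i + 1) n\<^sub>0 \<omega> *v u y \<omega>)
      powr exponent \<partial>M) \<le> rate * (\<integral>\<omega>. line_dist (u x \<omega>) (u y \<omega>) powr exponent \<partial>M)"
    using i' x y by (intro expectation_line_dist_powr_contracts u u_nz) auto
  also have "\<dots> \<le> rate * rate ^ m"
    using Suc rate_bounds by (intro mult_left_mono) (auto simp: u_def)
  finally show ?case by (simp only: split power_Suc)
qed

section \<open>Approximation of the increments\<close>

text \<open>If \<open>k - r \<le> 1\<close>, the window contains all factors and the increment itself is available. Otherwise
  the window starts after time \<open>i = k - r - 1 \<ge> 1\<close>, and \<open>x\<^sub>0\<close> serves as the vector at time \<open>i\<close>. The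
  first \<open>r mod n\<^sub>0\<close> steps of the window are absorbed into the two starting vectors \<open>x\<close> and \<open>y\<close>, as the
  contraction allows any starting vectors that are known from the past; so the number of the
  remaining steps is a multiple of \<open>n\<^sub>0\<close>.\<close>

lemma increment_approximation:
  assumes k: "k \<ge> 1" and x\<^sub>0: "x\<^sub>0 \<noteq> 0"
  obtains Y where "Y \<in> borel_measurable (generated_algebra M {k - int r..k} g)"
    and "AE \<omega> in M. \<bar>Y \<omega>\<bar> \<le> ln c"
    and "(\<integral>\<omega>. \<bar>increment g x\<^sub>0 k \<omega> - Y \<omega>\<bar> \<partial>M) \<le> 2 * c\<^sup>2 * rate ^ (r div n\<^sub>0)"
proof (cases "k - int r \<le> 1")
  case True
  show ?thesis
  proof (rule that[of "increment g x\<^sub>0 k"])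
    have [measurable]: "g k \<in> borel_measurable (generated_algebra M {k - int r..k} g)"
      "chain_product g 1 (nat (k - 1)) \<in> borel_measurable (generated_algebra M {k - int r..k} g)"
      using k True by (auto intro!: measurable_chain_product_generated measurable_generated_algebra)
    show "increment g x\<^sub>0 k \<in> borel_measurable (generated_algebra M {k - int r..k} g)"
      unfolding increment_def[abs_def] by measurable
    show "AE \<omega> in M. \<bar>increment g x\<^sub>0 k \<omega>\<bar> \<le> ln c"
      using distortion_g by eventually_elim (use k c_ge_1 in \<open>auto simp: increment_def intro!: abs_log_cocycle_le\<close>)
  qed (use rate_bounds in auto)
next
  case False
  define i where "i = k - int r - 1"
  have i: "i \<ge> 1" using False by (simp add: i_def)
  define l m where "l = r mod n\<^sub>0" and "m = r div n\<^sub>0"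
  have r: "r = l + n\<^sub>0 * m" by (simp add: l_def m_def)
  define x where "x \<omega> = chain_product g 1 (nat i + l) \<omega> *v x\<^sub>0" for \<omega>
  define y where "y \<omega> = chain_product g (i + 1) l \<omega> *v x\<^sub>0" for \<omega>
  define Q where "Q = chain_product g (i + int l + 1) (n\<^sub>0 * m)"
  define Y where "Y \<omega> = log_cocycle (g k \<omega>) (chain_product g (i + 1) r \<omega> *v x\<^sub>0)" for \<omega>
  have Qx: "chain_product g 1 (nat (k - 1)) \<omega> *v x\<^sub>0 = Q \<omega> *v x \<omega>" for \<omega>
  proof -
    have "nat (k - 1) = nat i + r"
      using i by (simp add: i_def)
    then have "nat (k - 1) = (nat i + l) + n\<^sub>0 * m"
      by (simp only: r add.assoc)
    then show ?thesis
      using chain_product_add[of g 1 "nat i + l" "n\<^sub>0 * m" \<omega>] i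
      by (simp add: Q_def x_def matrix_vector_mul_assoc add_ac)
  qed
  have Qy: "chain_product g (i + 1) r \<omega> *v x\<^sub>0 = Q \<omega> *v y \<omega>" for \<omega>
    using chain_product_add[of g "i + 1" l "n\<^sub>0 * m" \<omega>] r
    by (simp add: Q_def y_def matrix_vector_mul_assoc add_ac)
  have nz: "x \<omega> \<noteq> 0" "y \<omega> \<noteq> 0" if "\<omega> \<in> space M" for \<omega>
    unfolding x_def y_def using i x\<^sub>0 by (intro chain_product_nonzero that; simp)+
  then have Q_nz: "Q \<omega> *v x \<omega> \<noteq> 0" "Q \<omega> *v y \<omega> \<noteq> 0" if "\<omega> \<in> space M" for \<omega>
    unfolding Q_def using i that by (intro chain_product_nonzero that; simp)+
  have [measurable]: "x \<in> borel_measurable M" "y \<in> borel_measurable M" "Q \<in> borel_measurable M"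
    unfolding x_def[abs_def] y_def[abs_def] Q_def by measurable
  have [measurable]: "increment g x\<^sub>0 k \<in> borel_measurable M" "Y \<in> borel_measurable M"
    unfolding increment_def[abs_def] Y_def[abs_def] by measurable
  have int_ld: "integrable M (\<lambda>\<omega>. line_dist (Q \<omega> *v x \<omega>) (Q \<omega> *v y \<omega>) powr exponent)"
    using line_dist_powr_exponent_le_1 by (intro integrable_bounded[of _ 1]) auto
  have diff_le: "AE \<omega> in M. \<bar>increment g x\<^sub>0 k \<omega> - Y \<omega>\<bar>
      \<le> 2 * c\<^sup>2 * line_dist (Q \<omega> *v x \<omega>) (Q \<omega> *v y \<omega>) powr exponent"
    using distortion_g AE_space
  proof eventually_elim
    case (elim \<omega>)
    let ?d = "line_dist (Q \<omega> *v x \<omega>) (Q \<omega> *v y \<omega>)"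
    have "\<bar>increment g x\<^sub>0 k \<omega> - Y \<omega>\<bar> \<le> 2 * c\<^sup>2 * ?d"
      unfolding increment_def Y_def Qx Qy using elim k
      by (intro log_cocycle_lipschitz c_ge_1 Q_nz) auto
    also have "?d \<le> ?d powr exponent"
    proof (cases "?d = 0")
      case False
      then have "?d powr 1 \<le> ?d powr exponent"
        using exponent_bounds(2) line_dist_le_1 by (intro powr_mono') (auto simp: less_le)
      then show ?thesis by simp
    qed simp
    then have "2 * c\<^sup>2 * ?d \<le> 2 * c\<^sup>2 * ?d powr exponent"
      by (intro mult_left_mono) auto
    finally show ?case .
  qed
  show ?thesis
  proof (rule that[of Y])
    have [measurable]: "g k \<in> borel_measurable (generated_algebra M {k - int r..k} g)"
      "chain_product g (i + 1) r \<in> borel_measurable (generated_algebra M {k - int r..k} g)"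
      by (auto intro!: measurable_chain_product_generated measurable_generated_algebra simp: i_def)
    show "Y \<in> borel_measurable (generated_algebra M {k - int r..k} g)"
      unfolding Y_def[abs_def] by measurable
    show "AE \<omega> in M. \<bar>Y \<omega>\<bar> \<le> ln c"
      using distortion_g by eventually_elim (use k c_ge_1 in \<open>auto simp: Y_def intro!: abs_log_cocycle_le\<close>)
    have "(\<integral>\<omega>. \<bar>increment g x\<^sub>0 k \<omega> - Y \<omega>\<bar> \<partial>M)
        \<le> (\<integral>\<omega>. 2 * c\<^sup>2 * line_dist (Q \<omega> *v x \<omega>) (Q \<omega> *v y \<omega>) powr exponent \<partial>M)"
    proof (rule integral_mono_AE)
      show "integrable M (\<lambda>\<omega>. \<bar>increment g x\<^sub>0 k \<omega> - Y \<omega>\<bar>)"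
      proof (rule Bochner_Integration.integrable_bound)
        show "integrable M (\<lambda>\<omega>. 2 * c\<^sup>2 * line_dist (Q \<omega> *v x \<omega>) (Q \<omega> *v y \<omega>) powr exponent)"
          using int_ld by simp
        show "AE \<omega> in M. norm \<bar>increment g x\<^sub>0 k \<omega> - Y \<omega>\<bar>
            \<le> norm (2 * c\<^sup>2 * line_dist (Q \<omega> *v x \<omega>) (Q \<omega> *v y \<omega>) powr exponent)"
          using diff_le by eventually_elim auto
      qed simp
    qed (use int_ld diff_le in auto)
    also have "\<dots> = 2 * c\<^sup>2 * (\<integral>\<omega>. line_dist (Q \<omega> *v x \<omega>) (Q \<omega> *v y \<omega>) powr exponent \<partial>M)"
      by simp
    also have "\<dots> \<le> 2 * c\<^sup>2 * rate ^ m"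
    proof (rule mult_left_mono)
      show "(\<integral>\<omega>. line_dist (Q \<omega> *v x \<omega>) (Q \<omega> *v y \<omega>) powr exponent \<partial>M) \<le> rate ^ m"
        unfolding Q_def
      proof (rule expectation_line_dist_powr_decay)
        show "x \<in> borel_measurable (past (i + int l))" "y \<in> borel_measurable (past (i + int l))"
          unfolding x_def[abs_def] y_def[abs_def] using i
          by (auto intro!: borel_measurable_matrix_vector_mult measurable_chain_product_generated)
      qed (use i nz in auto)
    qed simp
    finally show "(\<integral>\<omega>. \<bar>increment g x\<^sub>0 k \<omega> - Y \<omega>\<bar> \<partial>M) \<le> 2 * c\<^sup>2 * rate ^ (r div n\<^sub>0)"
      by (simp add: m_def)
  qed
qed

end

section \<open>From the mean to the other \<open>L\<^sup>p\<close> norms\<close>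

lemma Lp_norm_le:
  assumes "(\<integral>\<^sup>+ \<omega>. ennreal (\<bar>f \<omega>\<bar> powr p) \<partial>M) \<le> ennreal b" and "0 \<le> b" and "0 \<le> p"
  shows "Lp_norm M p f \<le> ennreal (b powr (1 / p))"
proof -
  let ?I = "\<integral>\<^sup>+ \<omega>. ennreal (\<bar>f \<omega>\<bar> powr p) \<partial>M"
  have "?I \<noteq> \<infinity>" using assms(1) by (auto simp: top_unique)
  moreover have "enn2real ?I \<le> b"
    using enn2real_mono[OF assms(1)] assms(2) by simp
  ultimately show ?thesis
    unfolding Lp_norm_def Let_def using assms(3) by (auto intro!: ennreal_leI powr_mono2)
qed

text \<open>As \<open>E[Y|F] = Y\<close>, the error is \<open>(X - Y) - E[X - Y|F]\<close>, whose absolute value has mean at most \<open>2 e\<close>. It is bounded by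
  \<open>2 B\<close>, so the \<open>p\<close>-th power of its absolute value is at most \<open>(2 B)\<close> to the power \<open>p - 1\<close> times that value.\<close>

lemma (in prob_space) Lp_cond_exp_error_le:
  assumes F: "subalgebra M F"
    and X: "X \<in> borel_measurable M" "AE \<omega> in M. \<bar>X \<omega>\<bar> \<le> B"
    and Y: "Y \<in> borel_measurable F" "AE \<omega> in M. \<bar>Y \<omega>\<bar> \<le> B"
    and XY: "(\<integral>\<omega>. \<bar>X \<omega> - Y \<omega>\<bar> \<partial>M) \<le> e"
    and p: "1 \<le> p"
  shows "Lp_norm M p (\<lambda>\<omega>. X \<omega> - real_cond_exp M F X \<omega>)
    \<le> ennreal (((2 * B) powr (p - 1) * (2 * e)) powr (1 / p))"
proof -
  interpret F: sigma_finite_subalgebra M F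
    using F by (rule sigma_finite_subalgebraI)
  have [measurable]: "X \<in> borel_measurable M" "Y \<in> borel_measurable M"
    using X(1) Y(1) by (auto intro: measurable_from_subalg[OF F])
  define E where "E = real_cond_exp M F X"
  define D where "D = real_cond_exp M F (\<lambda>\<omega>. X \<omega> - Y \<omega>)"
  have [measurable]: "E \<in> borel_measurable M" "D \<in> borel_measurable M"
    by (simp_all add: E_def D_def)
  have int: "integrable M X" "integrable M Y"
    using X Y by (auto intro: integrable_bounded)
  then have int_XY: "integrable M (\<lambda>\<omega>. X \<omega> - Y \<omega>)" by simp
  then have int_D: "integrable M D"
    unfolding D_def by (rule F.real_cond_exp_int(1))
  have E_bound: "AE \<omega> in M. \<bar>E \<omega>\<bar> \<le> B"
    unfolding E_def by (rule abs_cond_exp_le[OF F X])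
  have int_E: "integrable M E"
    using E_bound by (intro integrable_bounded) auto
  have E_eq: "AE \<omega> in M. X \<omega> - E \<omega> = (X \<omega> - Y \<omega>) - D \<omega>"
    using F.real_cond_exp_diff[OF int] F.real_cond_exp_F_meas[OF int(2) Y(1)]
    by eventually_elim (simp add: E_def D_def)
  have "(\<integral>\<omega>. \<bar>D \<omega>\<bar> \<partial>M) \<le> (\<integral>\<omega>. \<bar>X \<omega> - Y \<omega>\<bar> \<partial>M)"
  proof -
    have "(\<integral>\<^sup>+\<omega>. ennreal \<bar>D \<omega>\<bar> \<partial>M) \<le> (\<integral>\<^sup>+\<omega>. nn_cond_exp M F (\<lambda>\<omega>. ennreal \<bar>X \<omega> - Y \<omega>\<bar>) \<omega> \<partial>M)"
      unfolding D_def by (intro nn_integral_mono_AE F.real_cond_exp_abs) simp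
    also have "\<dots> = (\<integral>\<^sup>+\<omega>. ennreal \<bar>X \<omega> - Y \<omega>\<bar> \<partial>M)"
      using F.nn_cond_exp_intg[of "\<lambda>_. 1" "\<lambda>\<omega>. ennreal \<bar>X \<omega> - Y \<omega>\<bar>"] by simp
    finally show ?thesis
      using int_D int_XY by (simp add: nn_integral_eq_integral)
  qed
  then have L1: "(\<integral>\<omega>. \<bar>X \<omega> - E \<omega>\<bar> \<partial>M) \<le> 2 * e"
  proof -
    have "(\<integral>\<omega>. \<bar>X \<omega> - E \<omega>\<bar> \<partial>M) \<le> (\<integral>\<omega>. \<bar>X \<omega> - Y \<omega>\<bar> + \<bar>D \<omega>\<bar> \<partial>M)"
    proof (rule integral_mono_AE)
      show "AE \<omega> in M. \<bar>X \<omega> - E \<omega>\<bar> \<le> \<bar>X \<omega> - Y \<omega>\<bar> + \<bar>D \<omega>\<bar>"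
        using E_eq by eventually_elim linarith
    qed (use int_XY int_D int_E int in auto)
    also have "\<dots> = (\<integral>\<omega>. \<bar>X \<omega> - Y \<omega>\<bar> \<partial>M) + (\<integral>\<omega>. \<bar>D \<omega>\<bar> \<partial>M)"
      using int_XY int_D by simp
    finally show ?thesis
      using XY \<open>(\<integral>\<omega>. \<bar>D \<omega>\<bar> \<partial>M) \<le> (\<integral>\<omega>. \<bar>X \<omega> - Y \<omega>\<bar> \<partial>M)\<close> by linarith
  qed
  have "0 \<le> e"
    using XY by (rule order_trans[rotated]) simp
  have "(\<integral>\<^sup>+ \<omega>. ennreal (\<bar>X \<omega> - E \<omega>\<bar> powr p) \<partial>M) \<le> (\<integral>\<^sup>+ \<omega>. ennreal ((2 * B) powr (p - 1) * \<bar>X \<omega> - E \<omega>\<bar>) \<partial>M)"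
  proof (rule nn_integral_mono_AE)
    show "AE \<omega> in M. ennreal (\<bar>X \<omega> - E \<omega>\<bar> powr p) \<le> ennreal ((2 * B) powr (p - 1) * \<bar>X \<omega> - E \<omega>\<bar>)"
      using X(2) E_bound
    proof eventually_elim
      case (elim \<omega>)
      let ?d = "\<bar>X \<omega> - E \<omega>\<bar>"
      have "?d powr p = ?d powr (p - 1) * ?d"
        using powr_add[of ?d "p - 1" 1] by simp
      also have "\<dots> \<le> (2 * B) powr (p - 1) * ?d"
        using elim p by (intro mult_right_mono powr_mono2) auto
      finally show ?case by (rule ennreal_leI)
    qed
  qed
  also have "\<dots> = ennreal (\<integral>\<omega>. (2 * B) powr (p - 1) * \<bar>X \<omega> - E \<omega>\<bar> \<partial>M)"
    using int int_E by (intro nn_integral_eq_integral) auto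
  also have "\<dots> \<le> ennreal ((2 * B) powr (p - 1) * (2 * e))"
    using L1 by (intro ennreal_leI) (auto intro: mult_left_mono)
  finally show ?thesis
    unfolding E_def[symmetric] using p \<open>0 \<le> e\<close> by (intro Lp_norm_le) auto
qed

context contracting_chain
begin

theorem increment_cond_exp_error:
  assumes x\<^sub>0: "x\<^sub>0 \<noteq> 0"
  shows "\<exists>\<rho>::real. 0 < \<rho> \<and> \<rho> < 1 \<and>
    (\<forall>p::real. p \<ge> 1 \<longrightarrow>
      (SUP k\<in>{1..}. SUP r::nat.
         ennreal (\<rho> powr (- real r / p)) *
         Lp_norm M p (\<lambda>\<omega>. increment g x\<^sub>0 k \<omega> -
           real_cond_exp M (generated_algebra M {k - int r..k} g) (increment g x\<^sub>0 k) \<omega>)) < \<infinity>)"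
proof -
  \<comment> \<open>One factor \<open>rate\<close> is gained every \<open>n\<^sub>0\<close> steps; rounding \<open>r / n\<^sub>0\<close> down costs at most one factor.\<close>
  define \<rho> where "\<rho> = rate powr (1 / n\<^sub>0)"
  have \<rho>: "0 < \<rho>" "\<rho> < 1"
    using rate_bounds n\<^sub>0_pos powr_less_mono2[of "1 / n\<^sub>0" rate 1] by (auto simp: \<rho>_def)
  have rate_le: "rate ^ (r div n\<^sub>0) \<le> \<rho> powr r / rate" for r
  proof -
    have "r = n\<^sub>0 * (r div n\<^sub>0) + r mod n\<^sub>0" by simp
    also have "\<dots> \<le> n\<^sub>0 * (r div n\<^sub>0) + n\<^sub>0"
      using n\<^sub>0_pos by (intro add_left_mono) (simp add: less_imp_le)
    finally have "real r \<le> real (n\<^sub>0 * (r div n\<^sub>0) + n\<^sub>0)"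
      by (rule of_nat_mono)
    then have "real r / n\<^sub>0 - 1 \<le> real (r div n\<^sub>0)"
      using n\<^sub>0_pos by (simp add: divide_simps algebra_simps)
    then have "rate powr real (r div n\<^sub>0) \<le> rate powr (real r / n\<^sub>0 - 1)"
      using rate_bounds by (intro powr_mono') auto
    then show ?thesis
      using rate_bounds by (simp add: \<rho>_def powr_powr powr_diff powr_realpow)
  qed
  have "(SUP k\<in>{1..}. SUP r::nat.
         ennreal (\<rho> powr (- real r / p)) *
         Lp_norm M p (\<lambda>\<omega>. increment g x\<^sub>0 k \<omega> -
           real_cond_exp M (generated_algebra M {k - int r..k} g) (increment g x\<^sub>0 k) \<omega>)) < \<infinity>"
    if p: "p \<ge> 1" for p :: real
  proof -
    define K where "K = (2 * ln c) powr (p - 1) * (4 * c\<^sup>2 / rate)"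
    have K: "0 \<le> K" using rate_bounds by (simp add: K_def)
    have "ennreal (\<rho> powr (- real r / p)) *
         Lp_norm M p (\<lambda>\<omega>. increment g x\<^sub>0 k \<omega> -
           real_cond_exp M (generated_algebra M {k - int r..k} g) (increment g x\<^sub>0 k) \<omega>)
        \<le> ennreal (K powr (1 / p))" if k: "k \<ge> 1" for k and r :: nat
    proof -
      let ?F = "generated_algebra M {k - int r..k} g"
      obtain Y where Y: "Y \<in> borel_measurable ?F" "AE \<omega> in M. \<bar>Y \<omega>\<bar> \<le> ln c"
        "(\<integral>\<omega>. \<bar>increment g x\<^sub>0 k \<omega> - Y \<omega>\<bar> \<partial>M) \<le> 2 * c\<^sup>2 * rate ^ (r div n\<^sub>0)"
        using increment_approximation[OF k x\<^sub>0] by blast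
      have [measurable]: "increment g x\<^sub>0 k \<in> borel_measurable M"
        unfolding increment_def[abs_def] by measurable
      have bound: "AE \<omega> in M. \<bar>increment g x\<^sub>0 k \<omega>\<bar> \<le> ln c"
        using distortion_g by eventually_elim (use k c_ge_1 in \<open>auto simp: increment_def intro!: abs_log_cocycle_le\<close>)
      have "2 * c\<^sup>2 * rate ^ (r div n\<^sub>0) \<le> 2 * c\<^sup>2 * (\<rho> powr r / rate)"
        by (intro mult_left_mono rate_le) auto
      from Y(3) this have L1: "(\<integral>\<omega>. \<bar>increment g x\<^sub>0 k \<omega> - Y \<omega>\<bar> \<partial>M) \<le> 2 * c\<^sup>2 * (\<rho> powr r / rate)"
        by (rule order_trans)
      have "Lp_norm M p (\<lambda>\<omega>. increment g x\<^sub>0 k \<omega> - real_cond_exp M ?F (increment g x\<^sub>0 k) \<omega>)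
          \<le> ennreal (((2 * ln c) powr (p - 1) * (2 * (2 * c\<^sup>2 * (\<rho> powr r / rate)))) powr (1 / p))"
        by (rule Lp_cond_exp_error_le[OF subalgebra_X _ bound Y(1,2) L1 p]) simp
      also have "(2 * ln c) powr (p - 1) * (2 * (2 * c\<^sup>2 * (\<rho> powr r / rate))) = K * \<rho> powr r"
        by (simp add: K_def)
      also have "(K * \<rho> powr r) powr (1 / p) = K powr (1 / p) * \<rho> powr (r / p)"
        using K by (simp add: powr_mult powr_powr)
      finally have "ennreal (\<rho> powr (- real r / p)) *
          Lp_norm M p (\<lambda>\<omega>. increment g x\<^sub>0 k \<omega> - real_cond_exp M ?F (increment g x\<^sub>0 k) \<omega>)
        \<le> ennreal (\<rho> powr (- real r / p)) * ennreal (K powr (1 / p) * \<rho> powr (r / p))"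
        by (rule mult_left_mono) simp
      also have "\<dots> = ennreal (\<rho> powr (- real r / p) * (K powr (1 / p) * \<rho> powr (r / p)))"
        by (rule ennreal_mult[symmetric]) auto
      also have "\<rho> powr (- real r / p) * (K powr (1 / p) * \<rho> powr (r / p)) = K powr (1 / p)"
        using \<rho> by (simp add: powr_minus_divide)
      finally show ?thesis .
    qed
    then have "(SUP k\<in>{1..}. SUP r::nat.
         ennreal (\<rho> powr (- real r / p)) *
         Lp_norm M p (\<lambda>\<omega>. increment g x\<^sub>0 k \<omega> -
           real_cond_exp M (generated_algebra M {k - int r..k} g) (increment g x\<^sub>0 k) \<omega>))
        \<le> ennreal (K powr (1 / p))"
      by (intro SUP_least) auto
    also have "\<dots> < \<infinity>" by simp
    finally show ?thesis .
  qed
  with \<rho> show ?thesis by blast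
qed

end

theorem proposition5p2:
  fixes M :: "'a measure"
    and g :: "int \<Rightarrow> 'a \<Rightarrow> real^'n^'n"
    and A :: "real^'n^'n"
    and x\<^sub>0 :: "real^'n"
    and n\<^sub>0 :: nat and \<delta> :: real
  assumes "prob_space M"
    and "CARD('n) \<ge> 2"
    and "markov_chain M g"
    and "\<And>j \<omega>. j \<ge> 1 \<Longrightarrow> \<omega> \<in> space M \<Longrightarrow> invertible (g j \<omega>)"
    and "norm x\<^sub>0 = 1"
    and "bounded_cond_densities M g"
    and "(SUP j\<in>{1..}. esssup M (\<lambda>\<omega>. ennreal (matrix_size (g j \<omega>)))) < \<infinity>"
    and "invertible A"
    and "\<And>k \<omega>. k < 1 \<Longrightarrow> \<omega> \<in> space M \<Longrightarrow> g k \<omega> = A"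
    and "\<delta> > 0"
    and "\<And>j K L. j \<ge> 1 \<Longrightarrow> K \<in> proj_space \<Longrightarrow> L \<in> proj_space \<Longrightarrow> K \<noteq> L \<Longrightarrow>
      AE \<omega> in M. real_cond_exp M (generated_algebra M {j - 1} g)
        (\<lambda>\<omega>. ln (proj_dist ((*v) (chain_product g j n\<^sub>0 \<omega>) ` K) ((*v) (chain_product g j n\<^sub>0 \<omega>) ` L)
                 / proj_dist K L)) \<omega> \<le> - \<delta>"
  shows "\<exists>\<rho>::real. 0 < \<rho> \<and> \<rho> < 1 \<and>
    (\<forall>p::real. p \<ge> 1 \<longrightarrow>
      (SUP k\<in>{1..}. SUP r::nat.
         ennreal (\<rho> powr (- real r / p)) *
         Lp_norm M p (\<lambda>\<omega>. increment g x\<^sub>0 k \<omega> -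
           real_cond_exp M (generated_algebra M {k - int r..k} g) (increment g x\<^sub>0 k) \<omega>)) < \<infinity>)"
proof -
  interpret prob_space M by fact
  have meas [measurable]: "g i \<in> borel_measurable M" for i
  proof (cases "i \<ge> 1")
    case True
    then show ?thesis using assms(3) by (simp add: markov_chain_def)
  next
    case False
    then have "g i \<in> borel_measurable M \<longleftrightarrow> (\<lambda>_. A) \<in> borel_measurable M"
      using assms(9) by (intro measurable_cong) auto
    then show ?thesis by simp
  qed
  interpret markov_process M g
    using assms(3) meas by unfold_locales
  define s where "s = (SUP j\<in>{1..}. esssup M (\<lambda>\<omega>. ennreal (matrix_size (g j \<omega>))))"
  define c where "c = max 1 (enn2real s)"
  have distortion: "AE \<omega> in M. \<forall>i\<ge>1. distortion_le c (g i \<omega>)"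
  proof -
    have "AE \<omega> in M. 1 \<le> i \<longrightarrow> distortion_le c (g i \<omega>)" for i
    proof (cases "1 \<le> i")
      case True
      have "AE \<omega> in M. ennreal (matrix_size (g i \<omega>)) \<le> esssup M (\<lambda>\<omega>. ennreal (matrix_size (g i \<omega>)))"
        by (rule esssup_AE)
      then show ?thesis
        using AE_space
      proof eventually_elim
        case (elim \<omega>)
        have "ennreal (matrix_size (g i \<omega>)) \<le> s"
          unfolding s_def using True by (intro order_trans[OF elim(1)] SUP_upper) auto
        moreover have "s = ennreal (enn2real s)"
          using assms(7) by (simp add: s_def)
        ultimately have "ennreal (matrix_size (g i \<omega>)) \<le> ennreal (enn2real s)"
          by simp
        then have "matrix_size (g i \<omega>) \<le> c"
          unfolding c_def by (simp add: ennreal_le_iff2) linarith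
        then show ?case
          using assms(4)[OF True elim(2)] by (auto intro: distortion_le_if_matrix_size_le)
      qed
    qed auto
    then show ?thesis by (simp add: AE_all_countable)
  qed
  have drift: "AE \<omega> in M. real_cond_exp M (generated_algebra M {i} g) (\<lambda>\<omega>. ln (line_dist
        (chain_product g (i + 1) n\<^sub>0 \<omega> *v x) (chain_product g (i + 1) n\<^sub>0 \<omega> *v y) / line_dist x y)) \<omega>
        \<le> - \<delta>" if i: "i \<ge> 1" and xy: "wedge_norm x y \<noteq> 0" for i x y
  proof -
    let ?P = "chain_product g (i + 1) n\<^sub>0"
    have nz: "x \<noteq> 0" "y \<noteq> 0"
      using xy by (auto simp: wedge_norm_eq_sqrt)
    have ne: "span {x} \<noteq> span {y}"
    proof
      assume "span {x} = span {y}"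
      then have "y \<in> span {x}" by (simp add: span_base)
      then obtain t where "y = t *\<^sub>R x" by (auto simp: span_singleton)
      then show False
        using xy wedge_norm_shear[of x y t] by (simp add: wedge_norm_eq_sqrt)
    qed
    have eq: "ln (proj_dist ((*v) (?P \<omega>) ` span {x}) ((*v) (?P \<omega>) ` span {y}) / proj_dist (span {x}) (span {y}))
        = ln (line_dist (?P \<omega> *v x) (?P \<omega> *v y) / line_dist x y)" if "\<omega> \<in> space M" for \<omega>
    proof -
      have "?P \<omega> *v x \<noteq> 0" "?P \<omega> *v y \<noteq> 0"
        using i by (intro invertible_mult_vector_nonzero invertible_chain_product assms(4) that nz; simp)+
      then show ?thesis
        using nz by (simp add: image_span_singleton proj_dist_span line_dist_def)
    qed
    have [measurable]: "?P \<in> borel_measurable M"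
      by (rule borel_measurable_chain_product) simp
    have "(\<lambda>\<omega>. ln (line_dist (?P \<omega> *v x) (?P \<omega> *v y) / line_dist x y)) \<in> borel_measurable M"
      by measurable
    then have meas': "(\<lambda>\<omega>. ln (proj_dist ((*v) (?P \<omega>) ` span {x}) ((*v) (?P \<omega>) ` span {y})
        / proj_dist (span {x}) (span {y}))) \<in> borel_measurable M"
      using eq by (subst measurable_cong[OF eq])
    have "AE \<omega> in M. real_cond_exp M (generated_algebra M {i} g)
        (\<lambda>\<omega>. ln (proj_dist ((*v) (?P \<omega>) ` span {x}) ((*v) (?P \<omega>) ` span {y})
          / proj_dist (span {x}) (span {y}))) \<omega> \<le> - \<delta>"
      using assms(11)[of "i + 1" "span {x}" "span {y}"] i nz ne by (auto simp: proj_space_def)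
    moreover have "AE \<omega> in M. real_cond_exp M (generated_algebra M {i} g)
        (\<lambda>\<omega>. ln (proj_dist ((*v) (?P \<omega>) ` span {x}) ((*v) (?P \<omega>) ` span {y})
          / proj_dist (span {x}) (span {y}))) \<omega>
      = real_cond_exp M (generated_algebra M {i} g)
          (\<lambda>\<omega>. ln (line_dist (?P \<omega> *v x) (?P \<omega> *v y) / line_dist x y)) \<omega>"
      using eq meas' by (intro sigma_finite_subalgebra.real_cond_exp_cong sigma_finite_X) auto
    ultimately show ?thesis by eventually_elim simp
  qed
  \<comment> \<open>In dimension at least \<open>2\<close> there are two distinct lines. For \<open>n\<^sub>0 = 0\<close> they would not move, and the
    drift would be \<open>0\<close>.\<close>
  have "n\<^sub>0 > 0"
  proof (rule ccontr)
    assume "\<not> n\<^sub>0 > 0"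
    then have n\<^sub>0: "n\<^sub>0 = 0" by simp
    obtain a b :: 'n where "a \<noteq> b"
      using assms(2) card_le_Suc0_iff_eq[of "UNIV :: 'n set"] by fastforce
    define x y :: "real^'n" where "x = axis a 1" and "y = axis b 1"
    have xy: "wedge_norm x y = 1"
      using \<open>a \<noteq> b\<close> by (simp add: wedge_norm_eq_sqrt x_def y_def inner_axis_axis)
    then have "AE \<omega> in M. real_cond_exp M (generated_algebra M {1} g) (\<lambda>\<omega>. 0) \<omega> \<le> - \<delta>"
      using drift[of 1 x y] by (simp add: n\<^sub>0 line_dist_def x_def y_def)
    moreover have "AE \<omega> in M. real_cond_exp M (generated_algebra M {1} g) (\<lambda>\<omega>. 0) \<omega> = 0"
      by (intro sigma_finite_subalgebra.real_cond_exp_F_meas sigma_finite_X) auto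
    ultimately have "AE \<omega> in M. False"
      by eventually_elim (use assms(10) in auto)
    then show False by simp
  qed
  interpret contracting_chain M g c \<delta> n\<^sub>0
    by unfold_locales (use assms(4,10) distortion drift \<open>n\<^sub>0 > 0\<close> in \<open>auto simp: c_def\<close>)
  show ?thesis
    using assms(5) by (intro increment_cond_exp_error) auto
qed

end
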